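(* Let $\Gamma\subset PSL(3,\mathbb{C})$ be a discrete group. Then the equicontinuity set $Eq(\Gamma)$ of $\Gamma$ is a discontinuity region, i.e. $\Gamma$ acts properly and discontinuously on the open $\Gamma$-invariant set $Eq(\Gamma)$. Moreover, if $U\subset\mathbb{P}^2_{\mathbb{C}}$ is an open $\Gamma$-invariant subset such that its complement $\mathbb{P}^2_{\mathbb{C}}\setminus U$ contains at least three complex lines in general position, then $U\subset Eq(\Gamma)$. Furthermore, if Kulkarni's limit set $\Lambda(\Gamma)$ contains at least three complex lines in general position, then Kulkarni's discontinuity region $\Omega(\Gamma)=\mathbb{P}^2_{\mathbb{C}}\setminus\Lambda(\Gamma)$ is equal to $Eq(\Gamma)$.
   Context: $PSL(3,\mathbb{C})$ acts on the complex projective plane $\mathbb{P}^2_{\mathbb{C}}$ by projective transformations. A complex line is the projectivization of a 2-dimensional linear subspace of $\mathbb{C}^3$. Complex lines are in general position if they are pairwise distinct and no three of them pass through a common point. Equicontinuity set: $Eq(\Gamma)$ is the set of points $z\in\mathbb{P}^2_{\mathbb{C}}$ having an open neighborhood $U$ such that $\{\gamma|_U:\gamma\in\Gamma\}$ is a normal family, meaning that every sequence of distinct elements has a subsequence which converges uniformly on compact subsets of $U$. It is open and $\Gamma$-invariant. Properly and discontinuously: $\Gamma$ acts properly and discontinuously on a $\Gamma$-invariant open set $V$ if for every compact $K\subset V$ the set $\{\gamma\in\Gamma:\gamma(K)\cap K\neq\emptyset\}$ is finite. Kulkarni's limit set. For a nonempty set $K\subset\mathbb{P}^2_{\mathbb{C}}$,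 a point $q$ is a cluster point of the family $\{\gamma(K)\}_{\gamma\in\Gamma}$ if there are a sequence $(k_m)\subset K$ and a sequence $(\gamma_m)\subset\Gamma$ of distinct elements with $\gamma_m(k_m)\to q$; the cluster points of the orbit of a point $z$ are those of the family with $K=\{z\}$. Let $L_0(\Gamma)$ be the closure of the set of points of $\mathbb{P}^2_{\mathbb{C}}$ with infinite isotropy group in $\Gamma$; let $L_1(\Gamma)$ be the closure of the set of cluster points of the $\Gamma$-orbits of $z$, where $z$ runs over $\mathbb{P}^2_{\mathbb{C}}\setminus L_0(\Gamma)$; let $L_2(\Gamma)$ be the closure of the set of cluster points of the families $\{\gamma(K)\}_{\gamma\in\Gamma}$, where $K$ runs over all compact subsets of $\mathbb{P}^2_{\mathbb{C}}\setminus(L_0(\Gamma)\cup L_1(\Gamma))$. Then $\Lambda(\Gamma)=L_0(\Gamma)\cup L_1(\Gamma)\cup L_2(\Gamma)$ and $\Omega(\Gamma)=\mathbb{P}^2_{\mathbb{C}}\setminus\Lambda(\Gamma)$. *)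

theory Defs
  imports "HOL-Analysis.Analysis" "HOL-Algebra.Coset"
begin
definition same_line :: "complex^3 \<Rightarrow> complex^3 \<Rightarrow> bool"
  where "same_line v w \<longleftrightarrow> v \<noteq> 0 \<and> w \<noteq> 0 \<and> (\<exists>c. w = c *s v)"

lemma same_line_scale_nz: "same_line v w \<Longrightarrow> \<exists>c. c \<noteq> 0 \<and> w = c *s v"
  unfolding same_line_def by (metis vector_smult_lzero)

lemma part_equivp_same_line: "part_equivp same_line"
proof (rule part_equivpI)
  show "\<exists>x. same_line x x"
    unfolding same_line_def by (intro exI[of _ "axis 1 1"]) (metis axis_eq_0_iff one_neq_zero vector_smult_lid)
  show "symp same_line"
  proof (rule sympI)
    fix v w assume a: "same_line v w"
    then obtain c where c: "c \<noteq> 0" "w = c *s v" using same_line_scale_nz by blast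
    then have "v = (1/c) *s w" by (simp add: vector_smult_assoc)
    then show "same_line w v" using a unfolding same_line_def by blast
  qed
  show "transp same_line"
    by (rule transpI) (metis same_line_def vector_smult_assoc)
qed

text \<open>\<^term>\<open>proj v\<close> is the point with homogeneous coordinates \<^term>\<open>v\<close>; it is meaningful only for
  \<^prop>\<open>v \<noteq> 0\<close>.\<close>

quotient_type cp2 = "complex^3" / partial: same_line
  morphisms rep_cp2 proj
  by (rule part_equivp_same_line)

lemma proj_eq_iff:
  assumes "v \<noteq> 0" "w \<noteq> 0"
  shows "proj v = proj w \<longleftrightarrow> (\<exists>c. w = c *s v)"
proof -
  have "same_line v v" "same_line w w"
    using assms unfolding same_line_def by (metis vector_smult_lid)+
  then have "same_line v w \<longleftrightarrow> proj v = proj w"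
    using Quotient3_rel[OF Quotient3_cp2, of v w] by blast
  then show ?thesis using assms unfolding same_line_def by blast
qed

lemma proj_cases: obtains v where "v \<noteq> 0" "p = proj v"
proof -
  have "same_line (rep_cp2 p) (rep_cp2 p)" "proj (rep_cp2 p) = p"
    by (rule Quotient3_rep_reflp[OF Quotient3_cp2], rule Quotient3_abs_rep[OF Quotient3_cp2])
  then show ?thesis using that[of "rep_cp2 p"] by (auto simp: same_line_def)
qed

text \<open>The metric is the one induced by the injection that sends a point of the plane, i.e. a line
  in \<open>\<complex>\<^sup>3\<close>, to the matrix of the orthogonal projection onto it. It induces the quotient topology,
  see \<open>open_cp2_iff\<close> below.\<close>

lemma norm_vec_sq_complex: "(of_real (norm v))\<^sup>2 = (\<Sum>i\<in>UNIV. v$i * cnj (v$i))" for v :: "complex^3"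
proof -
  have "(norm v)\<^sup>2 = (\<Sum>i\<in>UNIV. (norm (v$i))\<^sup>2)"
    by (simp add: norm_vec_def L2_set_def sum_nonneg)
  then have "complex_of_real ((norm v)\<^sup>2) = (\<Sum>i\<in>UNIV. of_real ((norm (v$i))\<^sup>2))"
    by simp
  then show ?thesis by (simp only: of_real_sum complex_norm_square) (simp flip: complex_norm_square)
qed

lemma norm_vector_scalar_mult_complex: "norm (c *s v) = norm c * norm v" for v :: "complex^3"
  by (simp add: norm_vec_def norm_mult L2_set_right_distrib)

definition line_projector :: "complex^3 \<Rightarrow> complex^3^3"
  where "line_projector v = (\<chi> i j. v$i * cnj (v$j) / (of_real (norm v))\<^sup>2)"

lift_definition projector_of :: "cp2 \<Rightarrow> complex^3^3" is line_projector
proof -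
  fix v w :: "complex^3" assume "same_line v w"
  then obtain c where c: "c \<noteq> 0" "w = c *s v" using same_line_scale_nz by blast
  have "(c * v$i) * cnj (c * v$j) / (of_real (norm c * norm v))\<^sup>2
      = v$i * cnj (v$j) / (of_real (norm v))\<^sup>2" for i j
  proof -
    have "(c * v$i) * cnj (c * v$j) / (of_real (norm c * norm v))\<^sup>2
        = (c * cnj c) * (v$i * cnj (v$j)) / ((c * cnj c) * (of_real (norm v))\<^sup>2)"
    proof -
      have "(of_real (norm c * norm v))\<^sup>2 = c * cnj c * (of_real (norm v) :: complex)\<^sup>2"
        by (simp only: of_real_mult power_mult_distrib of_real_power[symmetric] complex_norm_square)
      then show ?thesis by (simp only: complex_cnj_mult mult_ac)
    qed
    also have "\<dots> = v$i * cnj (v$j) / (of_real (norm v))\<^sup>2"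
      using c(1) by (intro mult_divide_mult_cancel_left) simp
    finally show ?thesis .
  qed
  then show "line_projector v = line_projector w"
    by (simp add: c(2) line_projector_def norm_vector_scalar_mult_complex)
qed

lemma projector_of_proj: "v \<noteq> 0 \<Longrightarrow> projector_of (proj v) = line_projector v"
  by (rule projector_of.abs_eq) (metis same_line_def vector_smult_lid)

lemma line_projector_apply:
  "line_projector v *v x = ((\<Sum>j\<in>UNIV. cnj (v$j) * x$j) / (of_real (norm v))\<^sup>2) *s v"
  by (simp add: line_projector_def matrix_vector_mult_def vec_eq_iff sum_divide_distrib
      sum_distrib_left mult_ac)

lemma line_projector_apply_self: "v \<noteq> 0 \<Longrightarrow> line_projector v *v v = v"
proof -
  assume "v \<noteq> 0"
  have "(\<Sum>j\<in>UNIV. cnj (v$j) * v$j) = (of_real (norm v))\<^sup>2"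
    by (simp only: norm_vec_sq_complex mult.commute)
  then show ?thesis using \<open>v \<noteq> 0\<close> by (simp add: line_projector_apply)
qed

lemma inj_projector_of: "projector_of p = projector_of q \<Longrightarrow> p = q"
proof -
  assume e: "projector_of p = projector_of q"
  obtain v w where v: "v \<noteq> 0" "p = proj v" and w: "w \<noteq> 0" "q = proj w" by (metis proj_cases)
  have "line_projector v = line_projector w"
    using e v w by (simp add: projector_of_proj)
  then have "w = line_projector v *v w" using w line_projector_apply_self by metis
  then have "\<exists>c. w = c *s v" by (metis line_projector_apply)
  then show "p = q" using v w proj_eq_iff by blast
qed

instantiation cp2 :: metric_space
begin

definition dist_cp2 :: "cp2 \<Rightarrow> cp2 \<Rightarrow> real"
  where "dist_cp2 p q = norm (projector_of p - projector_of q)"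

definition uniformity_cp2 :: "(cp2 \<times> cp2) filter"
  where "uniformity_cp2 = (INF e\<in>{0<..}. principal {(x, y). dist x y < e})"

definition open_cp2 :: "cp2 set \<Rightarrow> bool"
  where "open_cp2 U \<longleftrightarrow> (\<forall>x\<in>U. \<forall>\<^sub>F (x', y) in uniformity. x' = x \<longrightarrow> y \<in> U)"

instance
proof
  fix x y z :: cp2
  show "dist x y = 0 \<longleftrightarrow> x = y"
    using inj_projector_of by (auto simp: dist_cp2_def)
  show "dist x y \<le> dist x z + dist y z"
    unfolding dist_cp2_def by (metis dist_norm dist_triangle2)
qed (simp_all only: uniformity_cp2_def open_cp2_def)

end

lemma continuous_on_proj: "continuous_on (- {0}) proj"
proof -
  have "continuous_on (- {0}) line_projector"
    unfolding line_projector_def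
    by (intro continuous_intros continuous_on_vec_lambda) auto
  then show ?thesis
    unfolding continuous_on_iff
    by (simp add: dist_cp2_def projector_of_proj dist_norm)
qed

lemma open_cp2_iff: "open U \<longleftrightarrow> open {v. v \<noteq> 0 \<and> proj v \<in> U}" for U :: "cp2 set"
proof
  assume "open U"
  then have "open (proj -` U \<inter> - {0})"
    using continuous_on_open_vimage[of "- {0}" proj] continuous_on_proj by blast
  moreover have "proj -` U \<inter> - {0} = {v. v \<noteq> 0 \<and> proj v \<in> U}" by auto
  ultimately show "open {v. v \<noteq> 0 \<and> proj v \<in> U}" by simp
next
  let ?V = "{v. v \<noteq> 0 \<and> proj v \<in> U}"
  assume V: "open ?V"
  show "open U"
    unfolding open_dist
  proof
    fix p assume "p \<in> U"
    obtain v where v: "v \<noteq> 0" "p = proj v" by (metis proj_cases)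
    have "open ((\<lambda>M. M *v v) -` ?V)"
      unfolding matrix_vector_mult_def
      by (intro open_vimage V continuous_intros continuous_on_vec_lambda)
    moreover have "projector_of p \<in> (\<lambda>M. M *v v) -` ?V"
      using v \<open>p \<in> U\<close> by (simp add: projector_of_proj line_projector_apply_self)
    ultimately obtain e where e: "e > 0"
      "\<And>M. dist M (projector_of p) < e \<Longrightarrow> M \<in> (\<lambda>M. M *v v) -` ?V"
      unfolding open_dist by blast
    have "q \<in> U" if q: "dist q p < e" for q
    proof -
      obtain w where w: "w \<noteq> 0" "q = proj w" by (metis proj_cases)
      have "projector_of q \<in> (\<lambda>M. M *v v) -` ?V"
        using q e(2) by (simp add: dist_cp2_def dist_norm)
      then have *: "line_projector w *v v \<noteq> 0" "proj (line_projector w *v v) \<in> U"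
        using w by (simp_all add: projector_of_proj)
      then have "proj w = proj (line_projector w *v v)"
        using w proj_eq_iff line_projector_apply by metis
      then show ?thesis using * w by simp
    qed
    then show "\<exists>e>0. \<forall>y. dist y p < e \<longrightarrow> y \<in> U" using e(1) by blast
  qed
qed

definition complex_line :: "cp2 set \<Rightarrow> bool"
  where "complex_line L \<longleftrightarrow> (\<exists>W. vec.subspace W \<and> vec.dim W = 2 \<and> L = proj ` (W - {0}))"

definition general_position :: "cp2 set set \<Rightarrow> bool"
  where "general_position \<L> \<longleftrightarrow> (\<forall>L\<in>\<L>. complex_line L) \<and>
    (\<forall>L1\<in>\<L>. \<forall>L2\<in>\<L>. \<forall>L3\<in>\<L>. L1 \<noteq> L2 \<and> L1 \<noteq> L3 \<and> L2 \<noteq> L3 \<longrightarrow> L1 \<inter> L2 \<inter> L3 = {})"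

definition contains_three_lines_gp :: "cp2 set \<Rightarrow> bool"
  where "contains_three_lines_gp S \<longleftrightarrow>
    (\<exists>\<L>. finite \<L> \<and> card \<L> \<ge> 3 \<and> general_position \<L> \<and> (\<forall>L\<in>\<L>. L \<subseteq> S))"

definition SL3 :: "(complex^3^3) monoid"
  where "SL3 = \<lparr>carrier = {A. det A = 1}, mult = (**), one = mat 1\<rparr>"

definition SL3_scalars :: "(complex^3^3) set"
  where "SL3_scalars = {A \<in> carrier SL3. \<exists>c. A = mat c}"

definition PSL3 :: "(complex^3^3) set monoid"
  where "PSL3 = SL3 Mod SL3_scalars"

lemma group_SL3: "group SL3"
proof (rule groupI)
  fix A assume "A \<in> carrier SL3"
  then have A: "det A = 1" by (simp add: SL3_def)
  then obtain B where B: "A ** B = mat 1" "B ** A = mat 1"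
    by (metis invertible_def invertible_det_nz one_neq_zero)
  then have "det B = 1" by (metis A det_I det_mul mult_1)
  then show "\<exists>B\<in>carrier SL3. B \<otimes>\<^bsub>SL3\<^esub> A = \<one>\<^bsub>SL3\<^esub>" using B by (auto simp: SL3_def)
qed (auto simp: SL3_def det_mul matrix_mul_assoc)

lemma mat_mult_left: "mat c ** A = (\<chi> i j. c * A$i$j)" for A :: "complex^3^3"
  by (simp add: matrix_matrix_mult_def mat_def vec_eq_iff if_distrib[of "\<lambda>x. x * _"] cong: if_cong)

lemma mat_mult_right: "A ** mat c = (\<chi> i j. c * A$i$j)" for A :: "complex^3^3"
  by (simp add: matrix_matrix_mult_def mat_def vec_eq_iff if_distrib[of "\<lambda>x. _ * x"] mult.commute cong: if_cong)

lemma mat_vector_mult: "mat c *v v = c *s v" for v :: "complex^3"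
  by (simp add: matrix_vector_mult_def mat_def vec_eq_iff if_distrib[of "\<lambda>x. x * _"] cong: if_cong)

lemma mat_commute: "mat c ** A = A ** mat c" for A :: "complex^3^3"
  by (simp add: mat_mult_left mat_mult_right)

lemma normal_SL3_scalars: "SL3_scalars \<lhd> SL3"
proof -
  interpret group SL3 by (rule group_SL3)
  have mm: "mat c ** mat d = (mat (c * d) :: complex^3^3)" for c d :: complex
    by (subst mat_mult_left) (simp add: mat_def vec_eq_iff)
  have "subgroup SL3_scalars SL3"
  proof (rule subgroupI)
    have "mat 1 \<in> SL3_scalars" by (auto simp: SL3_scalars_def SL3_def)
    then show "SL3_scalars \<noteq> {}" by blast
  next
    fix A assume a: "A \<in> SL3_scalars"
    then obtain c where c: "A = mat c" "det A = 1" by (auto simp: SL3_scalars_def SL3_def)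
    then have "c \<noteq> 0" by (auto simp: det_3)
    have "det (mat (1/c) :: complex^3^3) = 1"
      using c mm[of c "1/c"] \<open>c \<noteq> 0\<close> by (metis det_I det_mul mult_1 nonzero_mult_div_cancel_left times_divide_eq_right mult.right_neutral)
    moreover have "mat (1/c) ** A = mat 1" using mm c \<open>c \<noteq> 0\<close> by simp
    ultimately have "inv\<^bsub>SL3\<^esub> A = mat (1/c)"
      using c by (intro inv_equality) (auto simp: SL3_def)
    then show "inv\<^bsub>SL3\<^esub> A \<in> SL3_scalars"
      using \<open>det (mat (1/c)) = 1\<close> by (auto simp: SL3_scalars_def SL3_def)
  next
    fix A B assume "A \<in> SL3_scalars" "B \<in> SL3_scalars"
    then show "A \<otimes>\<^bsub>SL3\<^esub> B \<in> SL3_scalars"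
      by (auto simp: SL3_scalars_def SL3_def det_mul mm)
  qed (auto simp: SL3_scalars_def)
  moreover have "A \<otimes>\<^bsub>SL3\<^esub> N \<otimes>\<^bsub>SL3\<^esub> inv\<^bsub>SL3\<^esub> A \<in> SL3_scalars"
    if A: "A \<in> carrier SL3" and N: "N \<in> SL3_scalars" for A N
  proof -
    have Nc: "N \<in> carrier SL3" using N by (auto simp: SL3_scalars_def)
    have "A \<otimes>\<^bsub>SL3\<^esub> N = N \<otimes>\<^bsub>SL3\<^esub> A"
      using N by (auto simp: SL3_scalars_def SL3_def mat_commute)
    then have "A \<otimes>\<^bsub>SL3\<^esub> N \<otimes>\<^bsub>SL3\<^esub> inv\<^bsub>SL3\<^esub> A = N"
      using A Nc by (simp add: m_assoc)
    then show ?thesis using N by simp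
  qed
  ultimately show ?thesis by (simp add: normal_inv_iff)
qed

lemma group_PSL3: "group PSL3"
  unfolding PSL3_def by (rule normal.factorgroup_is_group[OF normal_SL3_scalars])

definition PSL3_class :: "complex^3^3 \<Rightarrow> (complex^3^3) set"
  where "PSL3_class A = SL3_scalars #>\<^bsub>SL3\<^esub> A"

lemma carrier_PSL3: "carrier PSL3 = PSL3_class ` {A. det A = 1}"
  unfolding PSL3_def carrier_FactGroup by (simp add: PSL3_class_def SL3_def)

text \<open>The quotient of the topology that \<open>SL(3,\<complex>)\<close> inherits from the space of matrices.\<close>

definition PSL3_topology :: "(complex^3^3) set topology"
  where "PSL3_topology = topology (\<lambda>U. U \<subseteq> carrier PSL3 \<and>
    openin (top_of_set (carrier SL3)) {A \<in> carrier SL3. PSL3_class A \<in> U})"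

lemma openin_PSL3_topology:
  "openin PSL3_topology U \<longleftrightarrow> U \<subseteq> carrier PSL3 \<and>
    openin (top_of_set (carrier SL3)) {A \<in> carrier SL3. PSL3_class A \<in> U}"
proof -
  let ?P = "\<lambda>U. {A \<in> carrier SL3. PSL3_class A \<in> U}"
  have 1: "?P (S \<inter> T) = ?P S \<inter> ?P T" for S T by auto
  have 2: "?P (\<Union>K) = \<Union>(?P ` K)" for K by auto
  have "istopology (\<lambda>U. U \<subseteq> carrier PSL3 \<and> openin (top_of_set (carrier SL3)) (?P U))"
    unfolding istopology_def 1 2 by blast
  then show ?thesis unfolding PSL3_topology_def by simp
qed

lemma quotient_map_PSL3_class:
  "quotient_map (top_of_set (carrier SL3)) PSL3_topology PSL3_class"
proof -
  have c: "carrier PSL3 = PSL3_class ` carrier SL3" by (simp add: carrier_PSL3 SL3_def)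
  have "{A \<in> carrier SL3. PSL3_class A \<in> carrier PSL3} = carrier SL3" using c by auto
  then have "openin PSL3_topology (carrier PSL3)"
    unfolding openin_PSL3_topology by simp
  then have "topspace PSL3_topology = carrier PSL3"
    by (meson openin_PSL3_topology openin_subset openin_topspace subset_antisym)
  then show ?thesis
    unfolding quotient_map_def by (simp add: openin_PSL3_topology c)
qed

definition discrete_subgroup :: "(complex^3^3) set set \<Rightarrow> bool"
  where "discrete_subgroup \<Gamma> \<longleftrightarrow>
    subgroup \<Gamma> PSL3 \<and> subtopology PSL3_topology \<Gamma> = discrete_topology \<Gamma>"

definition act :: "(complex^3^3) set \<Rightarrow> cp2 \<Rightarrow> cp2"
  where "act \<gamma> p = (THE q. \<exists>A\<in>\<gamma>. \<exists>v. v \<noteq> 0 \<and> p = proj v \<and> q = proj (A *v v))"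

lemma act_PSL3_class:
  assumes A: "det A = 1" and v: "v \<noteq> 0"
  shows "act (PSL3_class A) (proj v) = proj (A *v v)"
  unfolding act_def
proof (rule the_equality)
  interpret normal SL3_scalars SL3 by (rule normal_SL3_scalars)
  have "A \<in> PSL3_class A"
    unfolding PSL3_class_def using A by (intro rcos_self subgroup_axioms) (simp add: SL3_def)
  then show "\<exists>B\<in>PSL3_class A. \<exists>w. w \<noteq> 0 \<and> proj v = proj w \<and> proj (A *v v) = proj (B *v w)"
    using v by blast
next
  fix q assume "\<exists>B\<in>PSL3_class A. \<exists>w. w \<noteq> 0 \<and> proj v = proj w \<and> q = proj (B *v w)"
  then obtain B w where B: "B \<in> PSL3_class A" "w \<noteq> 0" "proj v = proj w" "q = proj (B *v w)"
    by blast
  obtain c where c: "B = mat c ** A" "det (mat c :: complex^3^3) = 1"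
    using B(1) by (auto simp: PSL3_class_def r_coset_def SL3_scalars_def SL3_def)
  obtain d where d: "w = d *s v" using B v proj_eq_iff by blast
  have nz: "M *v x \<noteq> 0" if "det M = 1" "x \<noteq> 0" for M :: "complex^3^3" and x
  proof -
    obtain N where "N ** M = mat 1"
      using \<open>det M = 1\<close> by (metis invertible_def invertible_det_nz one_neq_zero)
    then have "N *v (M *v x) = x" by (simp add: matrix_vector_mul_assoc)
    then show ?thesis using \<open>x \<noteq> 0\<close> by (metis matrix_vector_mult_0_right)
  qed
  have "det B = 1" using c A by (simp add: det_mul)
  have "B *v w = (c * d) *s (A *v v)"
    by (simp add: c d matrix_vector_mul_assoc[symmetric] mat_vector_mult vector_scalar_commute
        vector_smult_assoc)
  then have "proj (A *v v) = proj (B *v w)"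
    using nz[OF A v] nz[OF \<open>det B = 1\<close> B(2)] proj_eq_iff by blast
  then show "q = proj (A *v v)" using B by simp
qed

text \<open>\<^term>\<open>F\<close> is a family of maps with domain \<^term>\<open>U\<close>, represented as extensional functions.\<close>

definition normal_family :: "cp2 set \<Rightarrow> (cp2 \<Rightarrow> cp2) set \<Rightarrow> bool"
  where "normal_family U F \<longleftrightarrow>
    (\<forall>f::nat \<Rightarrow> cp2 \<Rightarrow> cp2. inj f \<and> range f \<subseteq> F \<longrightarrow>
      (\<exists>r h. strict_mono (r::nat \<Rightarrow> nat) \<and>
        (\<forall>K. compact K \<and> K \<subseteq> U \<longrightarrow> uniform_limit K (\<lambda>n. f (r n)) h sequentially)))"

definition equicontinuity_set :: "(complex^3^3) set set \<Rightarrow> cp2 set"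
  where "equicontinuity_set \<Gamma> =
    {z. \<exists>U. open U \<and> z \<in> U \<and> normal_family U ((\<lambda>\<gamma>. restrict (act \<gamma>) U) ` \<Gamma>)}"

definition invariant_set :: "(complex^3^3) set set \<Rightarrow> cp2 set \<Rightarrow> bool"
  where "invariant_set \<Gamma> V \<longleftrightarrow> (\<forall>\<gamma>\<in>\<Gamma>. act \<gamma> ` V = V)"

definition acts_properly_discontinuously :: "(complex^3^3) set set \<Rightarrow> cp2 set \<Rightarrow> bool"
  where "acts_properly_discontinuously \<Gamma> V \<longleftrightarrow>
    open V \<and> invariant_set \<Gamma> V \<and>
    (\<forall>K. compact K \<and> K \<subseteq> V \<longrightarrow> finite {\<gamma>\<in>\<Gamma>. act \<gamma> ` K \<inter> K \<noteq> {}})"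

definition cluster_points :: "(complex^3^3) set set \<Rightarrow> cp2 set \<Rightarrow> cp2 set"
  where "cluster_points \<Gamma> K =
    {q. \<exists>(k::nat \<Rightarrow> cp2) g. range k \<subseteq> K \<and> inj g \<and> range g \<subseteq> \<Gamma> \<and>
      (\<lambda>m. act (g m) (k m)) \<longlonglongrightarrow> q}"

definition kulkarni_L0 :: "(complex^3^3) set set \<Rightarrow> cp2 set"
  where "kulkarni_L0 \<Gamma> = closure {z. infinite {\<gamma>\<in>\<Gamma>. act \<gamma> z = z}}"

definition kulkarni_L1 :: "(complex^3^3) set set \<Rightarrow> cp2 set"
  where "kulkarni_L1 \<Gamma> = closure (\<Union>z \<in> - kulkarni_L0 \<Gamma>. cluster_points \<Gamma> {z})"

definition kulkarni_L2 :: "(complex^3^3) set set \<Rightarrow> cp2 set"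
  where "kulkarni_L2 \<Gamma> =
    closure (\<Union>K \<in> {K. compact K \<and> K \<subseteq> - (kulkarni_L0 \<Gamma> \<union> kulkarni_L1 \<Gamma>)}. cluster_points \<Gamma> K)"

definition kulkarni_limit_set :: "(complex^3^3) set set \<Rightarrow> cp2 set"
  where "kulkarni_limit_set \<Gamma> = kulkarni_L0 \<Gamma> \<union> kulkarni_L1 \<Gamma> \<union> kulkarni_L2 \<Gamma>"

definition kulkarni_region :: "(complex^3^3) set set \<Rightarrow> cp2 set"
  where "kulkarni_region \<Gamma> = - kulkarni_limit_set \<Gamma>"

end

theory Submission
  imports Defs
begin

text \<open>
  The proof studies sequences of group elements through limits of their matrices. Given a sequence
  of elements of the group, choose matrices that represent them and divide by the norm. By
  compactness of the unit sphere a subsequence converges to a matrix \<open>B \<noteq> 0\<close>. Away from the kernel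
  of \<open>B\<close> the maps converge, uniformly on compact sets, to the map that \<open>B\<close> induces
  (\<open>tendsto_act_lifts\<close>), so all questions concern the kernel.

  One observation decides them (\<open>preimage_kernels_accumulate\<close>): if a line \<open>L\<close> does not contain the
  whole image of \<open>B\<close>, then the preimages of \<open>L\<close> under the elements of the sequence converge to a
  line through all points of the kernel of \<open>B\<close>. Hence a point of the kernel is a limit of points
  whose images lie on \<open>L\<close>.

  \<^item> A point of the kernel is never an equicontinuity point (\<open>equicontinuity_set_avoids_kernel\<close>): the
    value there of a continuous limit map would have to be a point of the image of \<open>B\<close>, and it would
    also lie on \<open>L\<close> for a line \<open>L\<close> that misses this point.

  \<^item> An open invariant set that omits three lines in general position does not meet the kernel
    (\<open>limit_nonzero_if_three_lines_omitted\<close>): one of the lines does not contain the whole image of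
    \<open>B\<close>, and its preimages are omitted too. So such a set consists of equicontinuity points.

  Discreteness enters through inverses. The matrices of determinant 1 that represent distinct
  elements of a discrete group tend to infinity, and so do their inverses. Hence the normalized
  limit \<open>C\<close> of the inverses satisfies \<open>C B = 0\<close> (\<open>convergent_inverse_lifts\<close>). If equicontinuity points
  \<open>p\<close> were moved by distinct elements to points converging to an equicontinuity point \<open>q\<close>, then \<open>q\<close>
  would be \<open>B p\<close>, which the kernel of \<open>C\<close> contains; this contradicts the first item, and proves proper
  discontinuity (\<open>equicontinuity_orbit_escapes\<close>).

  For every discrete group, the equicontinuity set is disjoint from each of the three parts of
  Kulkarni's limit set: proper discontinuity excludes infinite isotropy and cluster points of orbits,
  and a cluster point \<open>q\<close> of images of a compact set, at which the inverses converge by the first item,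
  would make a point of the compact set a cluster point of the orbit of \<open>q\<close>. The reverse inclusion is the second item,
  applied to the complement of the limit set, which is open and invariant.
\<close>

section \<open>Sequences in the projective plane\<close>

lemma tendsto_matrix_vector_mult [tendsto_intros]:
  fixes M :: "'b \<Rightarrow> complex^'n^'m" and v :: "'b \<Rightarrow> complex^'n"
  assumes "(M \<longlongrightarrow> M0) F" "(v \<longlongrightarrow> v0) F"
  shows "((\<lambda>n. M n *v v n) \<longlongrightarrow> M0 *v v0) F"
  unfolding matrix_vector_mult_def
  by (intro vec_tendstoI) (auto intro!: tendsto_intros tendsto_vec_nth assms)

lemma tendsto_matrix_mult [tendsto_intros]:
  fixes M :: "'b \<Rightarrow> complex^'n^'m" and N :: "'b \<Rightarrow> complex^'k^'n"
  assumes "(M \<longlongrightarrow> M0) F" "(N \<longlongrightarrow> N0) F"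
  shows "((\<lambda>n. M n ** N n) \<longlongrightarrow> M0 ** N0) F"
  unfolding matrix_matrix_mult_def
  by (intro vec_tendstoI) (auto intro!: tendsto_intros tendsto_vec_nth assms)

lemma scaleR_matrix_vector_mult:
  fixes A :: "complex^'n^'m"
  shows "(c *\<^sub>R A) *v v = c *\<^sub>R (A *v v)"
  by (simp add: matrix_vector_mult_def vec_eq_iff scaleR_sum_right)

lemma scaleR_eq_vector_scalar_mult: "c *\<^sub>R v = complex_of_real c *s v" for v :: "complex^'n"
  by (auto simp: vec_eq_iff) (simp only: scaleR_conv_of_real)

lemma proj_scaleR: "v \<noteq> 0 \<Longrightarrow> c \<noteq> 0 \<Longrightarrow> proj (c *\<^sub>R v) = proj v"
  using proj_eq_iff[of v "c *\<^sub>R v"] by (auto simp: scaleR_eq_vector_scalar_mult)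

lemma proj_smult: "v \<noteq> 0 \<Longrightarrow> c \<noteq> 0 \<Longrightarrow> proj (c *s v) = proj v"
  using proj_eq_iff[of v "c *s v"] by auto

lemma tendsto_proj:
  assumes "(v \<longlongrightarrow> w) F" "w \<noteq> 0"
  shows "((\<lambda>n. proj (v n)) \<longlongrightarrow> proj w) F"
proof -
  have "isCont proj w"
    using continuous_on_eq_continuous_at[of "- {0}" proj] continuous_on_proj assms(2) by auto
  then show ?thesis using assms(1) by (rule isCont_tendsto_compose)
qed

text \<open>\<open>proj\<close> is an open map, so convergent sequences lift. An explicit lift near \<^term>\<open>v\<close> is obtained
  by orthogonally projecting \<^term>\<open>v\<close> to the lines \<^term>\<open>x n\<close>.\<close>

lemma convergent_lift:
  assumes "x \<longlonglongrightarrow> proj v" "v \<noteq> 0"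
  obtains w where "w \<longlonglongrightarrow> v" "\<And>n. w n \<noteq> 0" "\<And>n. proj (w n) = x n"
proof -
  define w where "w = (\<lambda>n. projector_of (x n) *v v)"
  have "(\<lambda>n. projector_of (x n)) \<longlonglongrightarrow> projector_of (proj v)"
    using assms(1) by (simp add: tendsto_dist_iff[of x] dist_cp2_def tendsto_dist_iff[of "\<lambda>n. projector_of (x n)"] dist_norm)
  then have "w \<longlonglongrightarrow> projector_of (proj v) *v v"
    unfolding w_def by (intro tendsto_intros)
  then have lim: "w \<longlonglongrightarrow> v"
    by (simp add: projector_of_proj line_projector_apply_self assms(2))
  have w: "proj (w n) = x n" if "w n \<noteq> 0" for n
  proof -
    obtain u where u: "u \<noteq> 0" "x n = proj u" by (metis proj_cases)
    then have "\<exists>c. w n = c *s u"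
      by (auto simp: w_def projector_of_proj line_projector_apply)
    then show ?thesis using u that proj_eq_iff by metis
  qed
  have "\<forall>n. \<exists>u. u \<noteq> 0 \<and> x n = proj u" by (metis proj_cases)
  then obtain u where u: "\<And>n. u n \<noteq> 0" "\<And>n. x n = proj (u n)" by metis
  \<comment> \<open>The projection can vanish for finitely many indices; there any lift will do.\<close>
  define w' where "w' = (\<lambda>n. if w n = 0 then u n else w n)"
  have "\<forall>\<^sub>F n in sequentially. w n \<noteq> 0"
    using lim assms(2) by (rule tendsto_imp_eventually_ne)
  then have "\<forall>\<^sub>F n in sequentially. w n = w' n"
    by eventually_elim (simp add: w'_def)
  with lim have "w' \<longlonglongrightarrow> v" by (rule Lim_transform_eventually)
  moreover have "w' n \<noteq> 0" "proj (w' n) = x n" for n using u w by (auto simp: w'_def)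
  ultimately show ?thesis using that by blast
qed

lemma compact_UNIV_cp2: "compact (UNIV :: cp2 set)"
proof -
  have "p \<in> proj ` sphere 0 1" for p
  proof -
    obtain v where v: "v \<noteq> 0" "p = proj v" by (metis proj_cases)
    then have "p = proj ((1 / norm v) *\<^sub>R v)" by (simp add: proj_scaleR)
    then show ?thesis using v(1) by auto
  qed
  then have "UNIV = proj ` sphere (0::complex^3) 1" by auto
  moreover have "continuous_on (sphere 0 1) proj"
    by (rule continuous_on_subset[OF continuous_on_proj]) auto
  ultimately show ?thesis
    by (metis compact_continuous_image compact_sphere)
qed

text \<open>By contradiction: points of a compact set at which the distance to the limit stays bounded below
  have a convergent subsequence. The index shift \<^term>\<open>s\<close> in the hypothesis is there because the
  offending points belong to a subsequence of \<^term>\<open>f\<close>.\<close>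

lemma uniform_limit_compactI:
  fixes f :: "nat \<Rightarrow> 'a::metric_space \<Rightarrow> 'b::metric_space"
  assumes "compact K"
    and lim: "\<And>x y s. (\<And>n. x n \<in> K) \<Longrightarrow> x \<longlonglongrightarrow> y \<Longrightarrow> y \<in> K \<Longrightarrow> strict_mono s
      \<Longrightarrow> (\<lambda>n. f (s n) (x n)) \<longlonglongrightarrow> h y \<and> (\<lambda>n. h (x n)) \<longlonglongrightarrow> h y"
  shows "uniform_limit K f h sequentially"
proof (rule ccontr)
  assume "\<not> ?thesis"
  then obtain e where e: "e > 0" "\<not> (\<forall>\<^sub>F n in sequentially. \<forall>x\<in>K. dist (f n x) (h x) < e)"
    unfolding uniform_limit_iff by blast
  define B where "B = {n. \<exists>x\<in>K. dist (f n x) (h x) \<ge> e}"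
  have "infinite B"
    using e(2) unfolding eventually_sequentially infinite_nat_iff_unbounded_le B_def
    by (auto simp: not_less)
  define s where "s = enumerate B"
  have s: "strict_mono s" "\<And>n. s n \<in> B"
    using \<open>infinite B\<close> by (auto simp: s_def strict_mono_enumerate enumerate_in_set)
  then have "\<forall>n. \<exists>x. x \<in> K \<and> dist (f (s n) x) (h x) \<ge> e" unfolding B_def by blast
  then obtain x where x: "\<And>n. x n \<in> K" "\<And>n. dist (f (s n) (x n)) (h (x n)) \<ge> e" by metis
  obtain y t where y: "y \<in> K" "strict_mono t" "(x \<circ> t) \<longlonglongrightarrow> y"
    using \<open>compact K\<close> x(1) unfolding compact_def by blast
  have "(\<lambda>n. f ((s \<circ> t) n) ((x \<circ> t) n)) \<longlonglongrightarrow> h y \<and> (\<lambda>n. h ((x \<circ> t) n)) \<longlonglongrightarrow> h y"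
    using x y s by (intro lim strict_mono_o) (auto simp only: o_def)
  then have "(\<lambda>n. dist (f ((s \<circ> t) n) ((x \<circ> t) n)) (h ((x \<circ> t) n))) \<longlonglongrightarrow> dist (h y) (h y)"
    by (intro tendsto_dist) auto
  then have "(\<lambda>n. dist (f (s (t n)) (x (t n))) (h (x (t n)))) \<longlonglongrightarrow> 0" by simp
  then have "e \<le> 0" using x(2) by (intro LIMSEQ_le_const) auto
  then show False using e(1) by simp
qed

section \<open>The action and its lifts to linear maps\<close>

lemma matrix_vector_mult_nonzero:
  assumes "det A = 1" "v \<noteq> 0"
  shows "A *v v \<noteq> (0::complex^3)"
proof -
  obtain N where "N ** A = mat 1"
    using assms(1) by (metis invertible_def invertible_det_nz one_neq_zero)
  then have "N *v (A *v v) = v" by (simp add: matrix_vector_mul_assoc)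
  then show ?thesis using \<open>v \<noteq> 0\<close> by (metis matrix_vector_mult_0_right)
qed

text \<open>The scalar \<^term>\<open>c\<close> is free because sequences of lifts have to be rescaled to converge: along a
  sequence that leaves every compact set of matrices of determinant 1, the rescaled lifts converge
  to a singular matrix.\<close>

definition lifts :: "complex^3^3 \<Rightarrow> (complex^3^3) set \<Rightarrow> bool"
  where "lifts M \<gamma> \<longleftrightarrow> (\<exists>c A. c \<noteq> 0 \<and> det A = 1 \<and> \<gamma> = PSL3_class A \<and> M = c *\<^sub>R A)"

lemma lifts_PSL3_class: "det A = 1 \<Longrightarrow> lifts A (PSL3_class A)"
  unfolding lifts_def by (metis scaleR_one zero_neq_one)

lemma lifts_scaleR: "lifts M \<gamma> \<Longrightarrow> c \<noteq> 0 \<Longrightarrow> lifts (c *\<^sub>R M) \<gamma>"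
  unfolding lifts_def by (metis mult_eq_0_iff scaleR_scaleR)

lemma lifts_apply:
  assumes "lifts M \<gamma>" "v \<noteq> 0"
  shows lifts_nonzero: "M *v v \<noteq> 0" and act_proj: "act \<gamma> (proj v) = proj (M *v v)"
proof -
  obtain c A where *: "c \<noteq> 0" "det A = 1" "\<gamma> = PSL3_class A" "M = c *\<^sub>R A"
    using assms(1) unfolding lifts_def by blast
  with assms(2) matrix_vector_mult_nonzero[of A v] act_PSL3_class[of A v]
  show "M *v v \<noteq> 0" "act \<gamma> (proj v) = proj (M *v v)"
    by (simp_all add: scaleR_matrix_vector_mult proj_scaleR)
qed

lemma PSL3_representative:
  assumes "\<gamma> \<in> carrier PSL3"
  obtains A where "det A = 1" "\<gamma> = PSL3_class A"
  using assms unfolding carrier_PSL3 by blast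

lemma PSL3_class_in_carrier: "det A = 1 \<Longrightarrow> PSL3_class A \<in> carrier PSL3"
  unfolding carrier_PSL3 by blast

lemma PSL3_class_mult:
  assumes "det A = 1" "det B = 1"
  shows "PSL3_class A \<otimes>\<^bsub>PSL3\<^esub> PSL3_class B = PSL3_class (A ** B)"
  using hom_mult[OF normal.r_coset_hom_Mod[OF normal_SL3_scalars], of A B] assms
  by (simp add: PSL3_def PSL3_class_def SL3_def)

lemma PSL3_class_one: "PSL3_class (mat 1) = \<one>\<^bsub>PSL3\<^esub>"
proof -
  interpret group PSL3 by (rule group_PSL3)
  have "PSL3_class (mat 1) \<otimes>\<^bsub>PSL3\<^esub> PSL3_class (mat 1) = PSL3_class (mat 1)"
    by (simp add: PSL3_class_mult)
  then show ?thesis using PSL3_class_in_carrier[of "mat 1"] by (simp add: r_cancel_one)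
qed

lemma PSL3_class_inv:
  assumes "det A = 1" "B ** A = mat 1"
  shows "inv\<^bsub>PSL3\<^esub> (PSL3_class A) = PSL3_class B"
proof -
  interpret group PSL3 by (rule group_PSL3)
  have "det B = 1" using assms by (metis det_I det_mul mult.right_neutral)
  then show ?thesis
    using assms by (intro inv_equality) (auto simp: PSL3_class_mult PSL3_class_one PSL3_class_in_carrier)
qed

lemma act_mult:
  assumes "\<gamma> \<in> carrier PSL3" "\<delta> \<in> carrier PSL3"
  shows "act (\<gamma> \<otimes>\<^bsub>PSL3\<^esub> \<delta>) p = act \<gamma> (act \<delta> p)"
proof -
  obtain A B where A: "det A = 1" "\<gamma> = PSL3_class A" and B: "det B = 1" "\<delta> = PSL3_class B"
    using assms by (metis PSL3_representative)
  obtain v where v: "v \<noteq> 0" "p = proj v" by (metis proj_cases)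
  show ?thesis
    using A B v by (simp add: PSL3_class_mult act_PSL3_class det_mul matrix_vector_mult_nonzero
        matrix_vector_mul_assoc)
qed

lemma act_one: "act \<one>\<^bsub>PSL3\<^esub> p = p"
proof -
  obtain v where v: "v \<noteq> 0" "p = proj v" by (metis proj_cases)
  then show ?thesis using act_PSL3_class[of "mat 1" v] by (simp add: PSL3_class_one)
qed

lemma act_inv:
  assumes "\<gamma> \<in> carrier PSL3"
  shows "act (inv\<^bsub>PSL3\<^esub> \<gamma>) (act \<gamma> p) = p" "act \<gamma> (act (inv\<^bsub>PSL3\<^esub> \<gamma>) p) = p"
proof -
  interpret group PSL3 by (rule group_PSL3)
  show "act (inv\<^bsub>PSL3\<^esub> \<gamma>) (act \<gamma> p) = p" "act \<gamma> (act (inv\<^bsub>PSL3\<^esub> \<gamma>) p) = p"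
    using assms by (simp_all flip: act_mult add: act_one)
qed

text \<open>Off the kernel of \<^term>\<open>B\<close> the maps converge to the one that \<^term>\<open>B\<close> induces, and the points may
  move during the passage to the limit. Applied to compact sets this gives uniform convergence;
  applied to moving orbit points it identifies cluster points.\<close>

lemma tendsto_act_lifts:
  assumes "\<And>n. lifts (M n) (g n)" "M \<longlonglongrightarrow> B" "x \<longlonglongrightarrow> proj v" "v \<noteq> 0" "B *v v \<noteq> 0"
  shows "(\<lambda>n. act (g n) (x n)) \<longlonglongrightarrow> proj (B *v v)"
proof -
  obtain w where w: "w \<longlonglongrightarrow> v" "\<And>n. w n \<noteq> 0" "\<And>n. proj (w n) = x n"
    using convergent_lift assms(3,4) by blast
  have "act (g n) (x n) = proj (M n *v w n)" for n
    using act_proj[OF assms(1) w(2)] w(3) by simp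
  moreover have "(\<lambda>n. proj (M n *v w n)) \<longlonglongrightarrow> proj (B *v v)"
    using w assms by (intro tendsto_proj tendsto_intros) auto
  ultimately show ?thesis by simp
qed

lemma tendsto_act:
  assumes "\<gamma> \<in> carrier PSL3" "x \<longlonglongrightarrow> y"
  shows "(\<lambda>n. act \<gamma> (x n)) \<longlonglongrightarrow> act \<gamma> y"
proof -
  obtain A where A: "det A = 1" "\<gamma> = PSL3_class A" using assms(1) by (metis PSL3_representative)
  obtain v where v: "v \<noteq> 0" "y = proj v" by (metis proj_cases)
  show ?thesis
    using tendsto_act_lifts[of "\<lambda>_. A" "\<lambda>_. \<gamma>" A x v] A v assms(2)
    by (simp add: lifts_PSL3_class matrix_vector_mult_nonzero act_PSL3_class)
qed

lemma continuous_on_act: "\<gamma> \<in> carrier PSL3 \<Longrightarrow> continuous_on S (act \<gamma>)"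
  unfolding continuous_on_sequentially by (auto simp: o_def tendsto_act)

lemma act_image_eq_vimage:
  assumes "\<gamma> \<in> carrier PSL3"
  shows "act \<gamma> ` S = act (inv\<^bsub>PSL3\<^esub> \<gamma>) -` S"
  using act_inv[OF assms] by (auto simp: image_iff) metis

lemma open_act_image:
  assumes "\<gamma> \<in> carrier PSL3" "open S"
  shows "open (act \<gamma> ` S)"
  using assms group.inv_closed[OF group_PSL3 assms(1)]
  by (simp add: act_image_eq_vimage continuous_on_act open_vimage)

lemma invariant_setI:
  assumes "subgroup \<Gamma> PSL3" "\<And>\<gamma>. \<gamma> \<in> \<Gamma> \<Longrightarrow> act \<gamma> ` S \<subseteq> S"
  shows "invariant_set \<Gamma> S"
  unfolding invariant_set_def
proof (intro ballI equalityI)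
  fix \<gamma> assume \<gamma>: "\<gamma> \<in> \<Gamma>"
  then show "act \<gamma> ` S \<subseteq> S" by (rule assms(2))
  have "inv\<^bsub>PSL3\<^esub> \<gamma> \<in> \<Gamma>" "\<gamma> \<in> carrier PSL3"
    using assms(1) \<gamma> subgroup.m_inv_closed subgroup.mem_carrier by metis+
  then show "S \<subseteq> act \<gamma> ` S" using assms(2) by (auto simp: act_image_eq_vimage)
qed

lemma invariant_set_closure:
  assumes "subgroup \<Gamma> PSL3" "invariant_set \<Gamma> S"
  shows "invariant_set \<Gamma> (closure S)"
proof (rule invariant_setI[OF assms(1)])
  fix \<gamma> assume \<gamma>: "\<gamma> \<in> \<Gamma>"
  then have "\<gamma> \<in> carrier PSL3" using assms(1) subgroup.mem_carrier by metis
  then have "act \<gamma> ` closure S \<subseteq> closure (act \<gamma> ` S)"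
    by (intro image_closure_subset continuous_on_act closure_subset) auto
  then show "act \<gamma> ` closure S \<subseteq> closure S"
    using assms(2) \<gamma> by (simp add: invariant_set_def)
qed

section \<open>Discreteness and divergence of matrices\<close>

lemma tendsto_det:
  fixes A :: "'b \<Rightarrow> complex^'n^'n"
  assumes "(A \<longlongrightarrow> L) F"
  shows "((\<lambda>n. det (A n)) \<longlongrightarrow> det L) F"
  unfolding det_def by (intro tendsto_intros tendsto_vec_nth assms)

text \<open>By Cramer's rule the entries of an inverse are quotients of determinants, hence continuous.\<close>

lemma tendsto_right_inverse:
  fixes A :: "'b \<Rightarrow> complex^'n^'n"
  assumes A: "(A \<longlongrightarrow> L) F" and N: "\<And>n. A n ** N n = mat 1" and L: "L ** L' = mat 1"
  shows "(N \<longlongrightarrow> L') F"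
proof -
  define c where "c = (\<lambda>M::complex^'n^'n. \<lambda>j k.
    det (\<chi> i l. if l = k then axis j 1 $ i else M$i$l) / det M)"
  have *: "det M \<noteq> 0" "M'$k$j = c M j k" if "M ** M' = mat 1" for M M' j k
  proof -
    show "det M \<noteq> 0" using that by (metis det_I det_mul mult_zero_left zero_neq_one)
    then have "M' *v axis j 1 = (\<chi> k. det (\<chi> i l. if l = k then axis j 1 $ i else M$i$l) / det M)"
      by (subst cramer[symmetric]) (simp_all add: matrix_vector_mul_assoc that)
    then have "(M' *v axis j 1) $ k = c M j k" by (simp add: c_def)
    then show "M'$k$j = c M j k" by (simp add: matrix_vector_mult_def axis_def if_distrib[of "\<lambda>x. _ * x"] cong: if_cong)
  qed
  have "((\<lambda>n. c (A n) j k) \<longlongrightarrow> c L j k) F" for j k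
    unfolding c_def using *(1)[OF L]
    by (intro tendsto_divide tendsto_det A vec_tendstoI) (simp_all add: tendsto_vec_nth[OF tendsto_vec_nth[OF A]])
  then show ?thesis
    by (intro vec_tendstoI) (simp add: *(2)[OF N] *(2)[OF L])
qed

lemma subgroup_carrier: "subgroup \<Gamma> PSL3 \<Longrightarrow> \<gamma> \<in> \<Gamma> \<Longrightarrow> \<gamma> \<in> carrier PSL3"
  using subgroup.mem_carrier by metis

lemma discrete_subgroup_subgroup: "discrete_subgroup \<Gamma> \<Longrightarrow> subgroup \<Gamma> PSL3"
  by (simp add: discrete_subgroup_def)

lemma discrete_subgroup_near_one:
  assumes "discrete_subgroup \<Gamma>"
  obtains T where "open T" "mat 1 \<in> T"
    "\<And>A. A \<in> T \<Longrightarrow> det A = 1 \<Longrightarrow> PSL3_class A \<in> \<Gamma> \<Longrightarrow> PSL3_class A = \<one>\<^bsub>PSL3\<^esub>"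
proof -
  have "\<one>\<^bsub>PSL3\<^esub> \<in> \<Gamma>"
    using assms discrete_subgroup_subgroup subgroup.one_closed by metis
  then have "openin (subtopology PSL3_topology \<Gamma>) {\<one>\<^bsub>PSL3\<^esub>}"
    using assms by (simp add: discrete_subgroup_def)
  then obtain U where U: "openin PSL3_topology U" "{\<one>\<^bsub>PSL3\<^esub>} = U \<inter> \<Gamma>"
    unfolding openin_subtopology by blast
  then obtain T where T: "open T" "{A \<in> carrier SL3. PSL3_class A \<in> U} = carrier SL3 \<inter> T"
    unfolding openin_PSL3_topology openin_open by blast
  have "mat 1 \<in> {A \<in> carrier SL3. PSL3_class A \<in> U}"
    using U(2) by (auto simp: PSL3_class_one SL3_def)
  then have "mat 1 \<in> T" using T(2) by blast
  moreover have "PSL3_class A = \<one>\<^bsub>PSL3\<^esub>" if "A \<in> T" "det A = 1" "PSL3_class A \<in> \<Gamma>" for A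
  proof -
    have "A \<in> carrier SL3 \<inter> T" using that by (simp add: SL3_def)
    then have "PSL3_class A \<in> U" using T(2) by blast
    then show ?thesis using that U(2) by blast
  qed
  ultimately show ?thesis using that T(1) by blast
qed

text \<open>A bounded subsequence would have a limit of determinant 1, so quotients of consecutive terms would
  tend to the identity. By discreteness these quotients would be trivial in the group, although the
  terms are distinct.\<close>

lemma discrete_subgroup_norm_at_top:
  assumes \<Gamma>: "discrete_subgroup \<Gamma>"
    and A: "\<And>n. det (A n) = 1" "\<And>n. PSL3_class (A n) \<in> \<Gamma>" "inj (\<lambda>n::nat. PSL3_class (A n))"
  shows "filterlim (\<lambda>n. norm (A n)) at_top sequentially"
proof (rule ccontr)
  assume "\<not> ?thesis"
  then obtain R where R: "\<not> (\<forall>\<^sub>F n in sequentially. R \<le> norm (A n))"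
    unfolding filterlim_at_top by blast
  define S where "S = {n. norm (A n) < R}"
  have "infinite S"
    using R unfolding eventually_sequentially infinite_nat_iff_unbounded_le S_def
    by (auto simp: not_le)
  define s where "s = enumerate S"
  have s: "strict_mono s" "\<And>n. s n \<in> S"
    using \<open>infinite S\<close> by (auto simp: s_def strict_mono_enumerate enumerate_in_set)
  then have "\<forall>n. (A \<circ> s) n \<in> cball 0 R" by (auto simp: S_def less_imp_le)
  moreover have "compact (cball (0::complex^3^3) R)" by simp
  ultimately obtain L t where t: "strict_mono t" "((A \<circ> s) \<circ> t) \<longlonglongrightarrow> L"
    unfolding compact_def by blast
  define E where "E = A \<circ> (s \<circ> t)"
  have E: "E \<longlonglongrightarrow> L" "\<And>n. det (E n) = 1" "\<And>n. PSL3_class (E n) \<in> \<Gamma>"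
    using t(2) A by (simp_all add: E_def o_assoc)
  have "(\<lambda>n. det (E n)) \<longlonglongrightarrow> det L" by (rule tendsto_det) (rule E)
  then have "det L = 1" using E(2) by (simp add: LIMSEQ_const_iff)
  have ex: "\<exists>N. M ** N = mat 1 \<and> N ** M = mat 1" if "det M = 1" for M :: "complex^3^3"
    using that by (metis invertible_def invertible_det_nz one_neq_zero)
  obtain L' where L': "L ** L' = mat 1" "L' ** L = mat 1" using ex[OF \<open>det L = 1\<close>] by blast
  have "\<forall>n. \<exists>N. E n ** N = mat 1 \<and> N ** E n = mat 1" using ex E(2) by blast
  then obtain N where N: "\<And>n. E n ** N n = mat 1" "\<And>n. N n ** E n = mat 1" by metis
  have "N \<longlonglongrightarrow> L'" by (rule tendsto_right_inverse[OF E(1) N(1) L'(1)])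
  moreover have "(\<lambda>n. E (Suc n)) \<longlonglongrightarrow> L" using E(1) by (rule LIMSEQ_Suc)
  ultimately have lim: "(\<lambda>n. N n ** E (Suc n)) \<longlonglongrightarrow> mat 1"
    using tendsto_matrix_mult[of N L' _ "\<lambda>n. E (Suc n)" L] L' by simp
  obtain T where T: "open T" "mat 1 \<in> T"
    "\<And>A. A \<in> T \<Longrightarrow> det A = 1 \<Longrightarrow> PSL3_class A \<in> \<Gamma> \<Longrightarrow> PSL3_class A = \<one>\<^bsub>PSL3\<^esub>"
    using discrete_subgroup_near_one[OF \<Gamma>] by blast
  have "\<forall>\<^sub>F n in sequentially. N n ** E (Suc n) \<in> T"
    using lim T(1,2) by (rule topological_tendstoD)
  then obtain n where n: "N n ** E (Suc n) \<in> T"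
    using eventually_happens' sequentially_bot by blast
  interpret group PSL3 by (rule group_PSL3)
  note sub = discrete_subgroup_subgroup[OF \<Gamma>]
  have dN: "det (N n) = 1" using N(1)[of n] E(2)[of n] by (metis det_I det_mul mult_1)
  have inv: "inv\<^bsub>PSL3\<^esub> (PSL3_class (E n)) = PSL3_class (N n)"
    by (rule PSL3_class_inv) (rule E N)+
  have prod: "PSL3_class (N n ** E (Suc n)) = inv\<^bsub>PSL3\<^esub> (PSL3_class (E n)) \<otimes>\<^bsub>PSL3\<^esub> PSL3_class (E (Suc n))"
    by (simp add: inv PSL3_class_mult dN E)
  also have "\<dots> \<in> \<Gamma>"
    using E(3) by (intro subgroup.m_closed[OF sub] subgroup.m_inv_closed[OF sub])
  finally have "PSL3_class (N n ** E (Suc n)) = \<one>\<^bsub>PSL3\<^esub>"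
    using n dN E(2) by (intro T) (auto simp: det_mul)
  then have "PSL3_class (E (Suc n)) = PSL3_class (E n)"
    using prod PSL3_class_in_carrier[OF E(2)]
    by (metis inv_closed inv_equality inv_inv)
  then have "s (t (Suc n)) = s (t n)"
    using A(3) by (simp add: E_def inj_eq inj_def)
  then show False
    using strict_mono_eq[OF s(1)] strict_mono_eq[OF t(1)] by simp
qed

section \<open>Limits of lifts\<close>

lemma normalized_subsequence:
  fixes A N :: "nat \<Rightarrow> complex^3^3"
  assumes "\<And>n. A n \<noteq> 0" "\<And>n. N n \<noteq> 0"
  obtains r B C where "strict_mono (r::nat \<Rightarrow> nat)" "B \<noteq> 0" "C \<noteq> 0"
    "(\<lambda>n. (1 / norm (A (r n))) *\<^sub>R A (r n)) \<longlonglongrightarrow> B"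
    "(\<lambda>n. (1 / norm (N (r n))) *\<^sub>R N (r n)) \<longlonglongrightarrow> C"
proof -
  define P where "P = (\<lambda>n. ((1 / norm (A n)) *\<^sub>R A n, (1 / norm (N n)) *\<^sub>R N n))"
  have "compact (sphere (0::complex^3^3) 1 \<times> sphere (0::complex^3^3) 1)"
    by (intro compact_Times compact_sphere)
  moreover have "\<forall>n. P n \<in> sphere 0 1 \<times> sphere 0 1"
    using assms by (simp add: P_def)
  ultimately obtain l r where l: "l \<in> sphere 0 1 \<times> sphere 0 1" "strict_mono r" "(P \<circ> r) \<longlonglongrightarrow> l"
    unfolding compact_def by blast
  from tendsto_fst[OF l(3)] tendsto_snd[OF l(3)] l(1,2) show ?thesis
    by (intro that[of r "fst l" "snd l"]) (auto simp: P_def)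
qed

lemma convergent_lifts:
  assumes "\<And>n::nat. g n \<in> carrier PSL3"
  obtains r M B where "strict_mono (r::nat \<Rightarrow> nat)" "\<And>n. lifts (M n) (g (r n))" "M \<longlonglongrightarrow> B" "B \<noteq> 0"
proof -
  have "\<forall>n. \<exists>A. det A = 1 \<and> g n = PSL3_class A" using assms by (metis PSL3_representative)
  then obtain A where A: "\<And>n. det (A n) = 1" "\<And>n. g n = PSL3_class (A n)" by metis
  have nz: "A n \<noteq> 0" for n using A(1)[of n] by (auto simp: det_3)
  obtain r B where r: "strict_mono r" "B \<noteq> 0"
    "(\<lambda>n. (1 / norm (A (r n))) *\<^sub>R A (r n)) \<longlonglongrightarrow> B"
    using normalized_subsequence[of A A] nz by blast
  moreover have "lifts ((1 / norm (A (r n))) *\<^sub>R A (r n)) (g (r n))" for n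
    using nz by (simp add: A lifts_scaleR lifts_PSL3_class)
  ultimately show ?thesis by (intro that[OF r(1) _ r(3,2)])
qed

text \<open>After division by the norms, the product of the lifts of an element and of its inverse is the
  identity matrix divided by the product of two norms that both tend to infinity. Therefore the
  limits satisfy \<^term>\<open>C ** B = 0\<close>: the image of one limit is swallowed by the kernel of the other.
  This is the only consequence of discreteness that the rest of the proof draws on.\<close>

lemma convergent_inverse_lifts:
  assumes \<Gamma>: "discrete_subgroup \<Gamma>" and g: "inj g" "range g \<subseteq> \<Gamma>"
  obtains r M N B C where "strict_mono (r::nat \<Rightarrow> nat)"
    "\<And>n. lifts (M n) (g (r n))" "\<And>n. lifts (N n) (inv\<^bsub>PSL3\<^esub> (g (r n)))"
    "M \<longlonglongrightarrow> B" "N \<longlonglongrightarrow> C" "B \<noteq> 0" "C \<noteq> 0" "C ** B = 0"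
proof -
  note sub = discrete_subgroup_subgroup[OF \<Gamma>]
  have gc: "g n \<in> carrier PSL3" for n using g(2) subgroup_carrier[OF sub] by blast
  have "\<forall>n. \<exists>A. det A = 1 \<and> g n = PSL3_class A" using gc by (metis PSL3_representative)
  then obtain A where A: "\<And>n. det (A n) = 1" "\<And>n. g n = PSL3_class (A n)" by metis
  have "\<forall>n. \<exists>N. N ** A n = mat 1"
    using A(1) by (metis invertible_def invertible_det_nz one_neq_zero)
  then obtain N where N: "\<And>n. N n ** A n = mat 1" by metis
  have dN: "det (N n) = 1" for n using N[of n] A(1)[of n] by (metis det_I det_mul mult.right_neutral)
  have inv: "inv\<^bsub>PSL3\<^esub> (g n) = PSL3_class (N n)" for n
    unfolding A(2) by (rule PSL3_class_inv) (rule A N)+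
  have nz: "A n \<noteq> 0" "N n \<noteq> 0" for n using A(1)[of n] dN[of n] by (auto simp: det_3)
  obtain r B C where r: "strict_mono r" "B \<noteq> 0" "C \<noteq> 0"
    "(\<lambda>n. (1 / norm (A (r n))) *\<^sub>R A (r n)) \<longlonglongrightarrow> B"
    "(\<lambda>n. (1 / norm (N (r n))) *\<^sub>R N (r n)) \<longlonglongrightarrow> C"
    using normalized_subsequence[of A N] nz by blast
  have l: "lifts ((1 / norm (A (r n))) *\<^sub>R A (r n)) (g (r n))"
    "lifts ((1 / norm (N (r n))) *\<^sub>R N (r n)) (inv\<^bsub>PSL3\<^esub> (g (r n)))" for n
    using nz by (simp_all add: inv) (simp_all add: A lifts_scaleR lifts_PSL3_class dN)
  have "filterlim (\<lambda>n. norm (A n)) at_top sequentially"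
    using A g by (intro discrete_subgroup_norm_at_top[OF \<Gamma>]) (auto simp flip: A(2))
  moreover have "filterlim (\<lambda>n. norm (N n)) at_top sequentially"
  proof (rule discrete_subgroup_norm_at_top[OF \<Gamma> dN])
    show "PSL3_class (N n) \<in> \<Gamma>" for n
      using g(2) subgroup.m_inv_closed[OF sub] by (auto simp flip: inv)
    show "inj (\<lambda>n. PSL3_class (N n))"
      using g(1) gc by (auto simp: inj_def simp flip: inv) (metis group.inv_inv group_PSL3)
  qed
  ultimately have "filterlim (\<lambda>n. norm (N n) * norm (A n)) at_top sequentially"
    by (intro filterlim_at_top_mult_at_top)
  then have "filterlim (\<lambda>n. norm (N (r n)) * norm (A (r n))) at_top sequentially"
    using filterlim_compose filterlim_subseq[OF r(1)] by blast
  then have "(\<lambda>n. 1 / (norm (N (r n)) * norm (A (r n)))) \<longlonglongrightarrow> 0"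
    by (rule real_tendsto_divide_at_top[OF tendsto_const])
  then have "(\<lambda>n. (1 / (norm (N (r n)) * norm (A (r n)))) *\<^sub>R (mat 1 :: complex^3^3)) \<longlonglongrightarrow> 0 *\<^sub>R mat 1"
    by (intro tendsto_intros)
  moreover have "((1 / norm (N (r n))) *\<^sub>R N (r n)) ** ((1 / norm (A (r n))) *\<^sub>R A (r n))
      = (1 / (norm (N (r n)) * norm (A (r n)))) *\<^sub>R mat 1" for n
  proof -
    have "(a *\<^sub>R X) ** (b *\<^sub>R Y) = (a * b) *\<^sub>R (X ** Y)" for a b and X Y :: "complex^3^3"
      by (simp add: matrix_matrix_mult_def vec_eq_iff scaleR_sum_right mult_ac)
    then show ?thesis by (simp add: N)
  qed
  ultimately have "(\<lambda>n. ((1 / norm (N (r n))) *\<^sub>R N (r n)) ** ((1 / norm (A (r n))) *\<^sub>R A (r n))) \<longlonglongrightarrow> 0"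
    by simp
  moreover have "(\<lambda>n. ((1 / norm (N (r n))) *\<^sub>R N (r n)) ** ((1 / norm (A (r n))) *\<^sub>R A (r n))) \<longlonglongrightarrow> C ** B"
    by (intro tendsto_intros r)
  ultimately have "C ** B = 0" using LIMSEQ_unique by blast
  then show ?thesis using that[OF r(1) l r(4,5,2,3)] by blast
qed

definition linear_form :: "complex^3 \<Rightarrow> complex^3 \<Rightarrow> complex"
  where "linear_form u v = (\<Sum>i\<in>UNIV. u$i * v$i)"

lemma linear_form_diff: "linear_form u (v - w) = linear_form u v - linear_form u w"
  by (simp add: linear_form_def sum_subtractf algebra_simps)

lemma linear_form_smult: "linear_form u (c *s v) = c * linear_form u v"
  by (simp add: linear_form_def sum_distrib_left mult_ac)

lemma linear_form_axis: "linear_form (axis i 1) v = v $ i"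
  by (simp add: linear_form_def axis_def if_distrib[of "\<lambda>x. x * _"] cong: if_cong)

lemma tendsto_linear_form:
  assumes "(v \<longlongrightarrow> w) F"
  shows "((\<lambda>n. linear_form u (v n)) \<longlongrightarrow> linear_form u w) F"
  unfolding linear_form_def by (intro tendsto_intros tendsto_vec_nth assms)

text \<open>The functionals \<^term>\<open>\<lambda>y. linear_form u (M n *v y)\<close> converge to a nonzero functional, so their
  kernels converge to its kernel. Here \<^term>\<open>v\<close> is corrected along \<^term>\<open>w\<close>, a direction transverse to
  the limit kernel, to land in the \<^term>\<open>n\<close>-th kernel.

  Since the kernel of \<^term>\<open>B\<close> is contained in the limit kernel, each point of the kernel of \<^term>\<open>B\<close> is
  a limit of points that are mapped into one given line. This is what prevents such points from
  having a neighbourhood on which the maps behave well.\<close>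

lemma preimage_kernels_accumulate:
  assumes M: "M \<longlonglongrightarrow> B" and w: "linear_form u (B *v w) \<noteq> 0" and v: "linear_form u (B *v v) = 0"
  obtains x where "x \<longlonglongrightarrow> v" "\<forall>\<^sub>F n in sequentially. linear_form u (M n *v x n) = 0"
proof -
  define c where "c = (\<lambda>n. linear_form u (M n *v v) / linear_form u (M n *v w))"
  define x where "x = (\<lambda>n. v - c n *s w)"
  have lim: "(\<lambda>n. linear_form u (M n *v y)) \<longlonglongrightarrow> linear_form u (B *v y)" for y
    by (intro tendsto_linear_form tendsto_intros M)
  then have "c \<longlonglongrightarrow> linear_form u (B *v v) / linear_form u (B *v w)"
    unfolding c_def using w by (intro tendsto_divide)
  then have "c \<longlonglongrightarrow> 0" using v by simp
  then have "x \<longlonglongrightarrow> v"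
    unfolding x_def by (intro vec_tendstoI) (auto intro!: tendsto_eq_intros)
  moreover have "\<forall>\<^sub>F n in sequentially. linear_form u (M n *v w) \<noteq> 0"
    using lim w by (rule tendsto_imp_eventually_ne)
  then have "\<forall>\<^sub>F n in sequentially. linear_form u (M n *v x n) = 0"
  proof eventually_elim
    case (elim n)
    then show ?case
      by (simp add: x_def c_def matrix_vector_mult_diff_distrib linear_form_diff
          vector_scalar_commute linear_form_smult)
  qed
  ultimately show ?thesis using that by blast
qed

section \<open>The equicontinuity set\<close>

lemma normal_familyD:
  assumes "normal_family U F" "inj f" "range f \<subseteq> F"
  shows "\<exists>r h. strict_mono (r :: nat \<Rightarrow> nat) \<and>
    (\<forall>K. compact K \<and> K \<subseteq> U \<longrightarrow> uniform_limit K (\<lambda>n. f (r n)) h sequentially)"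
  using assms unfolding normal_family_def by simp

lemma scalar_matrix_class_one:
  assumes "det (mat c :: complex^3^3) = 1"
  shows "PSL3_class (mat c) = \<one>\<^bsub>PSL3\<^esub>"
proof -
  interpret normal SL3_scalars SL3 by (rule normal_SL3_scalars)
  have *: "PSL3_class M = SL3_scalars" if "M \<in> SL3_scalars" for M
    unfolding PSL3_class_def using that by (rule rcos_const[OF group_SL3])
  have "mat c \<in> SL3_scalars" "mat 1 \<in> SL3_scalars"
    using assms by (auto simp: SL3_scalars_def SL3_def)
  then show ?thesis using * PSL3_class_one by metis
qed

text \<open>A matrix for which all vectors of an open cone are eigenvectors is scalar. Three vectors \<open>v\<close>,
  \<open>v + tw\<close> and \<open>v + 2tw\<close> of the cone suffice to see that \<open>w\<close> has the same eigenvalue as \<open>v\<close>, because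
  they are linearly dependent and, for \<open>w\<close> independent of \<open>v\<close>, pairwise independent.\<close>

lemma act_identity_on_open:
  assumes "\<gamma> \<in> carrier PSL3" "open U" "U \<noteq> {}" "\<And>p. p \<in> U \<Longrightarrow> act \<gamma> p = p"
  shows "\<gamma> = \<one>\<^bsub>PSL3\<^esub>"
proof -
  obtain A where A: "det A = 1" "\<gamma> = PSL3_class A" using assms(1) by (metis PSL3_representative)
  have eig: "\<exists>c. A *v v = c *s v" if "v \<noteq> 0" "proj v \<in> U" for v
    using that assms(4)[of "proj v"] A act_PSL3_class[of A v] proj_eq_iff[of v "A *v v"]
      matrix_vector_mult_nonzero[of A v] by auto
  obtain v where v: "v \<noteq> 0" "proj v \<in> U" using assms(3) by (metis ex_in_conv proj_cases)
  obtain c where c: "A *v v = c *s v" using eig[OF v] by blast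
  have "A *v w = c *s w" for w
  proof (cases "\<exists>d. w = d *s v")
    case True
    then show ?thesis using c by (auto simp: vector_scalar_commute vector_smult_assoc mult.commute)
  next
    case False
    have near: "\<forall>\<^sub>F n in sequentially. v + complex_of_real (a / real (Suc n)) *s w \<noteq> 0 \<and>
        proj (v + complex_of_real (a / real (Suc n)) *s w) \<in> U" for a
    proof -
      have "(\<lambda>n. (a / real (Suc n)) *\<^sub>R w) \<longlonglongrightarrow> 0 *\<^sub>R w"
        by (intro tendsto_scaleR tendsto_const LIMSEQ_Suc[OF lim_const_over_n])
      then have "(\<lambda>n. v + complex_of_real (a / real (Suc n)) *s w) \<longlonglongrightarrow> v + 0"
        by (intro tendsto_add tendsto_const) (simp add: scaleR_eq_vector_scalar_mult)
      then have lim: "(\<lambda>n. v + complex_of_real (a / real (Suc n)) *s w) \<longlonglongrightarrow> v" by simp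
      show ?thesis
        using tendsto_imp_eventually_ne[OF lim v(1)]
          topological_tendstoD[OF tendsto_proj[OF lim v(1)] assms(2) v(2)]
        by (rule eventually_conj)
    qed
    obtain n where n: "v + complex_of_real (1 / real (Suc n)) *s w \<noteq> 0"
      "proj (v + complex_of_real (1 / real (Suc n)) *s w) \<in> U"
      "v + complex_of_real (2 / real (Suc n)) *s w \<noteq> 0"
      "proj (v + complex_of_real (2 / real (Suc n)) *s w) \<in> U"
      using eventually_happens'[OF sequentially_bot eventually_conj[OF near[of 1] near[of 2]]] by blast
    define t where "t = complex_of_real (1 / real (Suc n))"
    have t: "t \<noteq> 0" "complex_of_real (2 / real (Suc n)) = 2 * t" by (simp_all add: t_def del: of_nat_Suc)
    obtain c1 where c1: "A *v (v + t *s w) = c1 *s (v + t *s w)"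
      using eig n(1,2) unfolding t_def by blast
    obtain c2 where c2: "A *v (v + (2 * t) *s w) = c2 *s (v + (2 * t) *s w)"
      using eig n(3,4) unfolding t(2) by blast
    have Aw1: "t *s (A *v w) = c1 *s (v + t *s w) - c *s v"
      using c1 c by (simp add: matrix_vector_right_distrib vector_scalar_commute algebra_simps)
    have Aw2: "(2 * t) *s (A *v w) = c2 *s (v + (2 * t) *s w) - c *s v"
      using c2 c by (simp add: matrix_vector_right_distrib vector_scalar_commute algebra_simps)
    \<comment> \<open>Eliminating \<^term>\<open>A *v w\<close> leaves a linear relation between \<^term>\<open>v\<close> and \<^term>\<open>w\<close>.\<close>
    have "2 *s (t *s (A *v w)) = (2 * t) *s (A *v w)" by (simp add: vector_smult_assoc)
    then have "2 *s (c1 *s (v + t *s w) - c *s v) = c2 *s (v + (2 * t) *s w) - c *s v"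
      by (simp only: Aw1 Aw2)
    then have rel: "(2 * t * (c1 - c2)) *s w = (c + c2 - 2 * c1) *s v"
      by (auto simp: vec_eq_iff algebra_simps)
    have "c1 = c2"
    proof (rule ccontr)
      assume "c1 \<noteq> c2"
      then have "w = (1 / (2 * t * (c1 - c2))) *s ((2 * t * (c1 - c2)) *s w)"
        using t by (simp add: vector_smult_assoc)
      then have "w = (1 / (2 * t * (c1 - c2)) * (c + c2 - 2 * c1)) *s v"
        unfolding rel by (simp only: vector_smult_assoc)
      then show False using False by blast
    qed
    then have "c = c1" using rel v(1) by (simp add: vec_eq_iff) auto
    then have "t *s (A *v w) = t *s (c *s w)"
      unfolding Aw1 by (simp add: vec_eq_iff algebra_simps)
    then show ?thesis using t(1) by (auto simp: vec_eq_iff)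
  qed
  then have "A = mat c" by (simp add: matrix_eq mat_vector_mult)
  then show ?thesis using A scalar_matrix_class_one by simp
qed

text \<open>Normality of a family is a statement about sequences of distinct maps, so sequences of distinct
  group elements must stay distinct after restriction to an open set.\<close>

lemma inj_on_restrict_act:
  assumes "open U" "U \<noteq> {}"
  shows "inj_on (\<lambda>\<gamma>. restrict (act \<gamma>) U) (carrier PSL3)"
proof (rule inj_onI)
  interpret group PSL3 by (rule group_PSL3)
  fix \<gamma> \<delta> assume *: "\<gamma> \<in> carrier PSL3" "\<delta> \<in> carrier PSL3"
    and "restrict (act \<gamma>) U = restrict (act \<delta>) U"
  then have "act \<gamma> p = act \<delta> p" if "p \<in> U" for p using that by (metis restrict_apply')
  then have "inv\<^bsub>PSL3\<^esub> \<delta> \<otimes>\<^bsub>PSL3\<^esub> \<gamma> = \<one>\<^bsub>PSL3\<^esub>"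
    using * assms by (intro act_identity_on_open[of _ U]) (auto simp: act_mult act_inv)
  then show "\<gamma> = \<delta>" using * by (metis inv_closed inv_equality inv_inv)
qed

lemma uniform_limit_tendsto_diagonal:
  fixes f :: "nat \<Rightarrow> 'a::topological_space \<Rightarrow> 'b::metric_space"
  assumes "uniform_limit K f h sequentially" "continuous_on K h"
    and "x \<longlonglongrightarrow> y" "y \<in> K" "\<forall>\<^sub>F n in sequentially. x n \<in> K"
  shows "(\<lambda>n. f n (x n)) \<longlonglongrightarrow> h y"
proof (rule tendstoI)
  fix e :: real assume "e > 0"
  then have "e / 2 > 0" by simp
  have "(\<lambda>n. h (x n)) \<longlonglongrightarrow> h y" by (rule continuous_on_tendsto_compose[OF assms(2-5)])
  then have "\<forall>\<^sub>F n in sequentially. dist (h (x n)) (h y) < e / 2"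
    using \<open>e / 2 > 0\<close> by (rule tendstoD)
  with uniform_limitD[OF assms(1) \<open>e / 2 > 0\<close>] assms(5)
  show "\<forall>\<^sub>F n in sequentially. dist (f n (x n)) (h y) < e"
  proof eventually_elim
    case (elim n)
    then have "dist (f n (x n)) (h (x n)) < e / 2" "dist (h (x n)) (h y) < e / 2" by blast+
    then show ?case using dist_triangle[of "f n (x n)" "h y" "h (x n)"] by linarith
  qed
qed

lemma open_equicontinuity_set: "open (equicontinuity_set \<Gamma>)"
proof -
  have "equicontinuity_set \<Gamma> = \<Union>{U. open U \<and> normal_family U ((\<lambda>\<gamma>. restrict (act \<gamma>) U) ` \<Gamma>)}"
    by (auto simp: equicontinuity_set_def)
  then show ?thesis by (simp add: open_Union)
qed

lemma normal_family_translate: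
  assumes sub: "subgroup \<Gamma> PSL3" and \<gamma>: "\<gamma> \<in> \<Gamma>"
    and U: "normal_family U ((\<lambda>\<delta>. restrict (act \<delta>) U) ` \<Gamma>)"
  shows "normal_family (act \<gamma> ` U) ((\<lambda>\<delta>. restrict (act \<delta>) (act \<gamma> ` U)) ` \<Gamma>)"
  unfolding normal_family_def
proof (intro allI impI)
  fix f :: "nat \<Rightarrow> cp2 \<Rightarrow> cp2"
  assume f: "inj f \<and> range f \<subseteq> (\<lambda>\<delta>. restrict (act \<delta>) (act \<gamma> ` U)) ` \<Gamma>"
  have \<gamma>c: "\<gamma> \<in> carrier PSL3" using sub \<gamma> by (rule subgroup_carrier)
  have "\<forall>n. \<exists>\<delta>. \<delta> \<in> \<Gamma> \<and> f n = restrict (act \<delta>) (act \<gamma> ` U)" using f by auto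
  then obtain d where d: "\<And>n. d n \<in> \<Gamma>" "\<And>n. f n = restrict (act (d n)) (act \<gamma> ` U)" by metis
  define f' where "f' = (\<lambda>n. restrict (act (d n \<otimes>\<^bsub>PSL3\<^esub> \<gamma>)) U)"
  have f': "f' n p = f n (act \<gamma> p)" if "p \<in> U" for n p
    using that subgroup_carrier[OF sub d(1)] \<gamma>c by (simp add: f'_def d(2) act_mult)
  have "inj f'"
  proof (rule injI)
    fix m n assume "f' m = f' n"
    then have "f m p = f n p" if "p \<in> act \<gamma> ` U" for p using that by (auto simp flip: f')
    moreover have "f m p = f n p" if "p \<notin> act \<gamma> ` U" for p using that by (simp add: d(2))
    ultimately have "f m = f n" by blast
    then show "m = n" using f by (auto dest: injD)
  qed
  moreover have "range f' \<subseteq> (\<lambda>\<delta>. restrict (act \<delta>) U) ` \<Gamma>"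
    using d(1) \<gamma> subgroup.m_closed[OF sub] by (auto simp: f'_def)
  ultimately obtain r h where r: "strict_mono (r :: nat \<Rightarrow> nat)"
    "\<forall>K. compact K \<and> K \<subseteq> U \<longrightarrow> uniform_limit K (\<lambda>n. f' (r n)) h sequentially"
    using normal_familyD[OF U, of f'] by blast
  have "uniform_limit K (\<lambda>n. f (r n)) (h \<circ> act (inv\<^bsub>PSL3\<^esub> \<gamma>)) sequentially"
    if K: "compact K" "K \<subseteq> act \<gamma> ` U" for K
  proof -
    let ?K = "act (inv\<^bsub>PSL3\<^esub> \<gamma>) ` K"
    have "compact ?K"
      using K(1) \<gamma>c by (intro compact_continuous_image continuous_on_act group.inv_closed[OF group_PSL3])
    moreover have KU: "?K \<subseteq> U" using K(2) act_inv[OF \<gamma>c] by auto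
    ultimately have ul: "uniform_limit ?K (\<lambda>n. f' (r n)) h sequentially" using r(2) by blast
    have "f' n (act (inv\<^bsub>PSL3\<^esub> \<gamma>) x) = f n x" if "x \<in> K" for n x
      using that KU f' act_inv[OF \<gamma>c] by (simp add: image_subset_iff)
    then show ?thesis
      using ul unfolding uniform_limit_iff by simp
  qed
  then show "\<exists>r h. strict_mono (r :: nat \<Rightarrow> nat) \<and>
      (\<forall>K. compact K \<and> K \<subseteq> act \<gamma> ` U \<longrightarrow> uniform_limit K (\<lambda>n. f (r n)) h sequentially)"
    using r(1) by blast
qed

lemma invariant_equicontinuity_set:
  assumes "subgroup \<Gamma> PSL3"
  shows "invariant_set \<Gamma> (equicontinuity_set \<Gamma>)"
proof (rule invariant_setI[OF assms])
  fix \<gamma> assume \<gamma>: "\<gamma> \<in> \<Gamma>"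
  show "act \<gamma> ` equicontinuity_set \<Gamma> \<subseteq> equicontinuity_set \<Gamma>"
  proof
    fix q assume "q \<in> act \<gamma> ` equicontinuity_set \<Gamma>"
    then obtain p U where p: "q = act \<gamma> p" "open U" "p \<in> U"
      "normal_family U ((\<lambda>\<delta>. restrict (act \<delta>) U) ` \<Gamma>)"
      unfolding equicontinuity_set_def by blast
    have "open (act \<gamma> ` U)" using p(2) subgroup_carrier[OF assms \<gamma>] by (intro open_act_image)
    then show "q \<in> equicontinuity_set \<Gamma>"
      using p normal_family_translate[OF assms \<gamma> p(4)] unfolding equicontinuity_set_def by blast
  qed
qed

text \<open>Suppose that \<^term>\<open>v\<close> is in the kernel and that a subsequence converges to \<^term>\<open>h\<close> uniformly near
  \<^term>\<open>proj v\<close>. Approaching \<^term>\<open>proj v\<close> along \<^term>\<open>v + t *s w\<close>, where the limit is known to be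
  \<^term>\<open>proj (B *v w)\<close>, determines \<^term>\<open>h (proj v)\<close> by continuity. Some coordinate of \<^term>\<open>B *v w\<close>
  is nonzero. But \<^term>\<open>proj v\<close> is also a limit of points whose images lie on the line where this
  coordinate vanishes, so \<^term>\<open>h (proj v)\<close> lies on that line as well.\<close>

lemma equicontinuity_set_avoids_kernel:
  assumes sub: "\<Gamma> \<subseteq> carrier PSL3" and g: "inj g" "range g \<subseteq> \<Gamma>"
    and M: "\<And>n::nat. lifts (M n) (g n)" "M \<longlonglongrightarrow> B" "B \<noteq> 0"
    and v: "v \<noteq> 0" "proj v \<in> equicontinuity_set \<Gamma>"
  shows "B *v v \<noteq> 0"
proof
  assume Bv: "B *v v = 0"
  obtain U where U: "open U" "proj v \<in> U" "normal_family U ((\<lambda>\<gamma>. restrict (act \<gamma>) U) ` \<Gamma>)"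
    using v(2) unfolding equicontinuity_set_def by blast
  define f where "f = (\<lambda>n. restrict (act (g n)) U)"
  have "inj f"
  proof (rule injI)
    fix m n assume "f m = f n"
    moreover have "g m \<in> carrier PSL3" "g n \<in> carrier PSL3" using sub g(2) by auto
    ultimately have "g m = g n"
      using inj_onD[OF inj_on_restrict_act[of U]] U(1,2) unfolding f_def by blast
    then show "m = n" using g(1) by (simp add: inj_eq)
  qed
  moreover have "range f \<subseteq> (\<lambda>\<gamma>. restrict (act \<gamma>) U) ` \<Gamma>" using g(2) by (auto simp: f_def)
  ultimately obtain r h where r: "strict_mono (r :: nat \<Rightarrow> nat)"
    "\<forall>K. compact K \<and> K \<subseteq> U \<longrightarrow> uniform_limit K (\<lambda>n. f (r n)) h sequentially"
    using normal_familyD[OF U(3), of f] by blast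
  obtain e where e: "e > 0" "cball (proj v) e \<subseteq> U" using U(1,2) open_contains_cball by blast
  define K where "K = cball (proj v) e"
  have "compact K" using compact_Int_closed[OF compact_UNIV_cp2, of K] by (simp add: K_def)
  then have "uniform_limit K (\<lambda>n. f (r n)) h sequentially" using r(2) e(2) by (simp add: K_def)
  moreover have "f n x = act (g n) x" if "x \<in> K" for n x using that e(2) by (auto simp: f_def K_def)
  ultimately have ul: "uniform_limit K (\<lambda>n. act (g (r n))) h sequentially"
    using uniform_limit_cong'[of K "\<lambda>n. f (r n)" "\<lambda>n. act (g (r n))" h h] by simp
  have cont: "continuous_on K h"
    using g(2) sub by (intro uniform_limit_theorem[OF _ ul] always_eventually allI continuous_on_act) auto
  have inK: "\<forall>\<^sub>F n in sequentially. x n \<in> K" if "x \<longlonglongrightarrow> proj v" for x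
    using tendstoD[OF that e(1)] by eventually_elim (simp add: K_def dist_commute)
  have vK: "proj v \<in> K" using e(1) by (simp add: K_def)
  have Mr: "(\<lambda>n. M (r n)) \<longlonglongrightarrow> B" using LIMSEQ_subseq_LIMSEQ[OF M(2) r(1)] by (simp add: o_def)
  obtain w where w: "B *v w \<noteq> 0" using M(3) matrix_eq[of B 0] by auto
  \<comment> \<open>The path towards \<^term>\<open>v\<close> in the direction of \<^term>\<open>w\<close>: on it the limit is constant.\<close>
  have hv: "h (proj v) = proj (B *v w)"
  proof -
    define y where "y = (\<lambda>n. v + (1 / real (Suc n)) *\<^sub>R w)"
    have "(\<lambda>n. (1 / real (Suc n)) *\<^sub>R w) \<longlonglongrightarrow> 0 *\<^sub>R w"
      by (intro tendsto_scaleR tendsto_const LIMSEQ_Suc[OF lim_const_over_n])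
    then have "y \<longlonglongrightarrow> v + 0" unfolding y_def by (intro tendsto_add tendsto_const) simp
    then have lim: "(\<lambda>n. proj (y n)) \<longlonglongrightarrow> proj v" using v(1) by (intro tendsto_proj) simp_all
    have By: "B *v y n = (1 / real (Suc n)) *\<^sub>R (B *v w)" for n
      by (simp add: y_def matrix_vector_right_distrib Bv scaleR_eq_vector_scalar_mult vector_scalar_commute)
    then have By0: "B *v y n \<noteq> 0" "y n \<noteq> 0" for n using w by (auto dest: arg_cong[of _ _ "(*v) B"])
    have "h (proj (y n)) = proj (B *v w)" if "proj (y n) \<in> K" for n
    proof -
      have "(\<lambda>m. act (g (r m)) (proj (y n))) \<longlonglongrightarrow> proj (B *v y n)"
        using By0 by (intro tendsto_act_lifts[OF M(1) Mr]) auto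
      moreover have "(\<lambda>m. act (g (r m)) (proj (y n))) \<longlonglongrightarrow> h (proj (y n))"
        using tendsto_uniform_limitI[OF ul that] .
      moreover have "proj (B *v y n) = proj (B *v w)" using w unfolding By by (simp add: proj_scaleR)
      ultimately show ?thesis using LIMSEQ_unique by metis
    qed
    then have "\<forall>\<^sub>F n in sequentially. h (proj (y n)) = proj (B *v w)"
      using inK[OF lim] by (simp add: eventually_mono)
    then have "(\<lambda>n. h (proj (y n))) \<longlonglongrightarrow> proj (B *v w)" by (rule tendsto_eventually)
    moreover have "(\<lambda>n. h (proj (y n))) \<longlonglongrightarrow> h (proj v)"
      using cont lim vK inK[OF lim] by (rule continuous_on_tendsto_compose)
    ultimately show ?thesis using LIMSEQ_unique by blast
  qed
  obtain i where i: "(B *v w) $ i \<noteq> 0" using w by (auto simp: vec_eq_iff)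
  obtain x where x: "x \<longlonglongrightarrow> v" "\<forall>\<^sub>F n in sequentially. (M (r n) *v x n) $ i = 0"
    using preimage_kernels_accumulate[OF Mr, of "axis i 1" w v] i Bv
    by (auto simp: linear_form_axis)
  have px: "(\<lambda>n. proj (x n)) \<longlonglongrightarrow> proj v" using x(1) v(1) by (rule tendsto_proj)
  have "(\<lambda>n. act (g (r n)) (proj (x n))) \<longlonglongrightarrow> proj (B *v w)"
    using uniform_limit_tendsto_diagonal[OF ul cont px vK inK[OF px]] hv by simp
  \<comment> \<open>Lifting the image points makes the vanishing of a coordinate a closed condition on vectors.\<close>
  then obtain q where q: "q \<longlonglongrightarrow> B *v w" "\<And>n. q n \<noteq> 0"
      "\<And>n. proj (q n) = act (g (r n)) (proj (x n))"
    using convergent_lift[OF _ w] by blast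
  have "\<forall>\<^sub>F n in sequentially. x n \<noteq> 0" using x(1) v(1) by (rule tendsto_imp_eventually_ne)
  with x(2) have "\<forall>\<^sub>F n in sequentially. q n $ i = 0"
  proof eventually_elim
    case (elim n)
    then have "proj (M (r n) *v x n) = proj (q n)" using q(3) act_proj[OF M(1)] by simp
    then obtain c where "q n = c *s (M (r n) *v x n)"
      using proj_eq_iff q(2) lifts_nonzero[OF M(1)] elim by metis
    then show ?case using elim by simp
  qed
  then have "(\<lambda>n. q n $ i) \<longlonglongrightarrow> 0" by (rule tendsto_eventually)
  then show False using tendsto_vec_nth[OF q(1)] i LIMSEQ_unique by blast
qed

section \<open>Proper discontinuity on the equicontinuity set\<close>

text \<open>If both \<^term>\<open>p\<close> and \<^term>\<open>q\<close> were equicontinuity points, then \<^term>\<open>p\<close> would avoid the kernel of the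
  limit \<^term>\<open>B\<close>, so \<^term>\<open>q\<close> would be the image of \<^term>\<open>p\<close> under \<^term>\<open>B\<close>. That image lies in the kernel of
  the limit \<^term>\<open>C\<close> of the inverses, which \<^term>\<open>q\<close> has to avoid too.\<close>

lemma equicontinuity_orbit_escapes:
  assumes \<Gamma>: "discrete_subgroup \<Gamma>" and g: "inj g" "range g \<subseteq> \<Gamma>"
    and k: "k \<longlonglongrightarrow> p" "p \<in> equicontinuity_set \<Gamma>" and q: "(\<lambda>n::nat. act (g n) (k n)) \<longlonglongrightarrow> q"
  shows "q \<notin> equicontinuity_set \<Gamma>"
proof
  assume qE: "q \<in> equicontinuity_set \<Gamma>"
  note sub = discrete_subgroup_subgroup[OF \<Gamma>]
  have sc: "\<Gamma> \<subseteq> carrier PSL3" using sub by (rule subgroup.subset)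
  obtain r M N B C where r: "strict_mono (r::nat \<Rightarrow> nat)"
    and M: "\<And>n. lifts (M n) (g (r n))" and N: "\<And>n. lifts (N n) (inv\<^bsub>PSL3\<^esub> (g (r n)))"
    and lim: "M \<longlonglongrightarrow> B" "N \<longlonglongrightarrow> C" "B \<noteq> 0" "C \<noteq> 0" "C ** B = 0"
    using convergent_inverse_lifts[OF \<Gamma> g] by blast
  obtain v where v: "v \<noteq> 0" "p = proj v" by (metis proj_cases)
  have "inj r" using r by (rule strict_mono_imp_inj_on)
  then have gr: "inj (\<lambda>n. g (r n))" "range (\<lambda>n. g (r n)) \<subseteq> \<Gamma>"
    using g by (auto simp: inj_def)
  have Bv: "B *v v \<noteq> 0"
    using equicontinuity_set_avoids_kernel[OF sc gr M lim(1,3) v(1)] k(2) v(2) by simp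
  have "(\<lambda>n. act (g (r n)) (k (r n))) \<longlonglongrightarrow> proj (B *v v)"
    using LIMSEQ_subseq_LIMSEQ[OF k(1) r] v Bv
    by (intro tendsto_act_lifts[OF M lim(1)]) (auto simp: o_def)
  moreover have "(\<lambda>n. act (g (r n)) (k (r n))) \<longlonglongrightarrow> q"
    using LIMSEQ_subseq_LIMSEQ[OF q r] by (simp add: o_def)
  ultimately have qB: "q = proj (B *v v)" using LIMSEQ_unique by blast
  have "inj (\<lambda>n. inv\<^bsub>PSL3\<^esub> (g (r n)))"
    using gr sc by (auto simp: inj_def image_subset_iff)
      (metis group.inv_inv group_PSL3 subsetD)
  moreover have "range (\<lambda>n. inv\<^bsub>PSL3\<^esub> (g (r n))) \<subseteq> \<Gamma>"
    using gr(2) subgroup.m_inv_closed[OF sub] by blast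
  ultimately have "C *v (B *v v) \<noteq> 0"
    using equicontinuity_set_avoids_kernel[OF sc _ _ N lim(2,4) Bv] qE qB by simp
  then show False using lim(5) by (simp add: matrix_vector_mul_assoc)
qed

lemma equicontinuity_set_properly_discontinuous:
  assumes \<Gamma>: "discrete_subgroup \<Gamma>"
  shows "acts_properly_discontinuously \<Gamma> (equicontinuity_set \<Gamma>)"
  unfolding acts_properly_discontinuously_def
proof (intro conjI allI impI)
  show "open (equicontinuity_set \<Gamma>)" by (rule open_equicontinuity_set)
  show "invariant_set \<Gamma> (equicontinuity_set \<Gamma>)"
    by (rule invariant_equicontinuity_set[OF discrete_subgroup_subgroup[OF \<Gamma>]])
next
  fix K assume K: "compact K \<and> K \<subseteq> equicontinuity_set \<Gamma>"
  show "finite {\<gamma>\<in>\<Gamma>. act \<gamma> ` K \<inter> K \<noteq> {}}"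
  proof (rule ccontr)
    assume "infinite {\<gamma>\<in>\<Gamma>. act \<gamma> ` K \<inter> K \<noteq> {}}"
    then obtain g :: "nat \<Rightarrow> _" where g: "inj g" "range g \<subseteq> {\<gamma>\<in>\<Gamma>. act \<gamma> ` K \<inter> K \<noteq> {}}"
      using infinite_countable_subset by blast
    then have "\<forall>n. \<exists>x. x \<in> K \<and> act (g n) x \<in> K" by blast
    then obtain k where k: "\<And>n. k n \<in> K" "\<And>n. act (g n) (k n) \<in> K" by metis
    define P where "P = (\<lambda>n. (k n, act (g n) (k n)))"
    have "compact (K \<times> K)" using K by (simp add: compact_Times)
    moreover have "\<forall>n. P n \<in> K \<times> K" using k by (simp add: P_def)
    ultimately obtain l s where l: "l \<in> K \<times> K" "strict_mono (s::nat \<Rightarrow> nat)"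
      "(P \<circ> s) \<longlonglongrightarrow> l"
      unfolding compact_def by blast
    from tendsto_fst[OF l(3)] tendsto_snd[OF l(3)]
    have lim: "(k \<circ> s) \<longlonglongrightarrow> fst l" "(\<lambda>n. act ((g \<circ> s) n) ((k \<circ> s) n)) \<longlonglongrightarrow> snd l"
      by (simp_all add: o_def P_def)
    have gs: "inj (g \<circ> s)" "range (g \<circ> s) \<subseteq> \<Gamma>"
      using inj_compose[OF g(1) strict_mono_imp_inj_on[OF l(2)]] g(2) by auto
    have "snd l \<notin> equicontinuity_set \<Gamma>"
      using l(1) K by (intro equicontinuity_orbit_escapes[OF \<Gamma> gs lim(1) _ lim(2)]) auto
    then show False using l(1) K by auto
  qed
qed

section \<open>Open sets whose complement contains three lines in general position\<close>

text \<open>A line is the zero set of a linear form. Only this inclusion is stated because membership in the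
  line is always concluded from the vanishing of the form. For \<^term>\<open>x\<close> outside the plane \<^term>\<open>W\<close>, the
  coefficients of the form are the \<^term>\<open>x\<close>-components of the basis vectors modulo \<^term>\<open>W\<close>.\<close>

lemma complex_line_contains_kernel:
  assumes "complex_line L"
  obtains u where "\<And>y. y \<noteq> 0 \<Longrightarrow> linear_form u y = 0 \<Longrightarrow> proj y \<in> L"
proof -
  obtain W where W: "vec.subspace W" "vec.dim W = 2" "L = proj ` (W - {0})"
    using assms unfolding complex_line_def by blast
  have spW: "vec.span W = W" using W(1) by (simp add: vec.span_eq_iff)
  have dim3: "vec.dim (UNIV :: (complex^3) set) = 3" by (simp only: vec_dim_card) simp
  then have "W \<noteq> UNIV" using W(2) by auto
  then obtain x where x: "x \<notin> W" by auto
  have dim: "vec.dim (insert x W) = 3" using x W(2) by (simp add: vec.dim_insert spW)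
  have full: "vec.span (insert x W) = UNIV"
    using dim3 dim vec.dim_eq_full[of "insert x W"] unfolding vec.dimension_def vec.dim_UNIV by simp
  have "\<exists>c. axis i 1 - c *s x \<in> W" for i
    using full vec.span_insert[of x W] spW by auto
  then obtain \<kappa> where \<kappa>: "\<And>i. axis i 1 - \<kappa> i *s x \<in> W" by metis
  have "y \<in> W" if "linear_form (\<chi> i. \<kappa> i) y = 0" for y
  proof -
    have "(\<Sum>i\<in>UNIV. y$i *s (axis i 1 - \<kappa> i *s x)) \<in> W"
      using \<kappa> W(1) by (intro vec.subspace_sum vec.subspace_scale)
    also have "(\<Sum>i\<in>UNIV. y$i *s (axis i 1 - \<kappa> i *s x))
        = (\<Sum>i\<in>UNIV. y$i *s axis i 1) - linear_form (\<chi> i. \<kappa> i) y *s x"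
      by (simp add: linear_form_def vec_eq_iff algebra_simps sum_subtractf sum_distrib_left sum_distrib_right)
    also have "\<dots> = y" using that by (simp add: basis_expansion)
    finally show ?thesis .
  qed
  then show ?thesis using W(3) by (intro that) auto
qed

lemma rep_cp2: "rep_cp2 p \<noteq> 0" "proj (rep_cp2 p) = p"
  using Quotient3_rep_reflp[OF Quotient3_cp2, of p] Quotient3_abs_rep[OF Quotient3_cp2, of p]
  by (auto simp: same_line_def)

text \<open>The image of \<^term>\<open>B\<close> contains a point, and one of three lines in general position misses it. The
  preimages of this line under the group elements lie outside \<^term>\<open>U\<close> by invariance, and they
  accumulate at every point of the kernel of \<^term>\<open>B\<close>. Since \<^term>\<open>U\<close> is open, it does not meet the
  kernel.\<close>

lemma limit_nonzero_if_three_lines_omitted: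
  assumes inv: "invariant_set \<Gamma> U" "range g \<subseteq> \<Gamma>" and U: "open U" "contains_three_lines_gp (- U)"
    and M: "\<And>n::nat. lifts (M n) (g n)" "M \<longlonglongrightarrow> B" "B \<noteq> 0"
    and v: "v \<noteq> 0" "proj v \<in> U"
  shows "B *v v \<noteq> 0"
proof
  assume Bv: "B *v v = 0"
  obtain \<L> where \<L>: "finite \<L>" "card \<L> \<ge> 3" "general_position \<L>" "\<forall>L\<in>\<L>. L \<subseteq> - U"
    using U(2) unfolding contains_three_lines_gp_def by (elim exE conjE) (rule that)
  obtain T where T: "T \<subseteq> \<L>" "card T = 3" by (rule obtain_subset_with_card_n[OF \<L>(2)])
  obtain L1 L2 L3 where L123: "T = {L1, L2, L3}" "L1 \<noteq> L2" "L1 \<noteq> L3" "L2 \<noteq> L3"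
    using T(2) by (auto simp: card_3_iff)
  then have L: "L1 \<in> \<L>" "L2 \<in> \<L>" "L3 \<in> \<L>" using T(1) by auto
  then have empty: "L1 \<inter> L2 \<inter> L3 = {}"
    using \<L>(3) L123(2-4) by (simp add: general_position_def)
  obtain w where w: "B *v w \<noteq> 0" using M(3) matrix_eq[of B 0] by auto
  then obtain L where L': "L \<in> \<L>" "proj (B *v w) \<notin> L" using L empty by blast
  then have "complex_line L" using \<L>(3) by (simp add: general_position_def)
  then obtain u where u: "\<And>y. y \<noteq> 0 \<Longrightarrow> linear_form u y = 0 \<Longrightarrow> proj y \<in> L"
    using complex_line_contains_kernel by blast
  have "linear_form u (B *v w) \<noteq> 0" using u w L'(2) by blast
  moreover have "linear_form u (B *v v) = 0" by (simp add: Bv linear_form_def)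
  ultimately obtain x where x: "x \<longlonglongrightarrow> v" "\<forall>\<^sub>F n in sequentially. linear_form u (M n *v x n) = 0"
    using preimage_kernels_accumulate[OF M(2)] by blast
  have "\<forall>\<^sub>F n in sequentially. proj (x n) \<in> U"
    using tendsto_proj[OF x(1) v(1)] U(1) v(2) by (rule topological_tendstoD)
  moreover have "\<forall>\<^sub>F n in sequentially. x n \<noteq> 0" using x(1) v(1) by (rule tendsto_imp_eventually_ne)
  ultimately have "\<forall>\<^sub>F n in sequentially. False"
    using x(2)
  proof eventually_elim
    case (elim n)
    have "act (g n) (proj (x n)) \<in> U" using inv elim(1) unfolding invariant_set_def by blast
    then have "proj (M n *v x n) \<in> U" using act_proj[OF M(1) elim(2)] by simp
    moreover have "proj (M n *v x n) \<in> L" using u lifts_nonzero[OF M(1) elim(2)] elim(3) by blast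
    ultimately show ?case using \<L>(4) L'(1) by blast
  qed
  then show False by simp
qed

text \<open>The set \<^term>\<open>U\<close> itself serves as the neighbourhood of all its points: it misses the kernel of each
  limit of lifts, so subsequences converge uniformly on its compact subsets.\<close>

lemma three_lines_omitted_subset_equicontinuity_set:
  assumes sub: "subgroup \<Gamma> PSL3"
    and U: "open U" "invariant_set \<Gamma> U" "contains_three_lines_gp (- U)"
  shows "U \<subseteq> equicontinuity_set \<Gamma>"
proof -
  have "normal_family U ((\<lambda>\<gamma>. restrict (act \<gamma>) U) ` \<Gamma>)"
    unfolding normal_family_def
  proof (intro allI impI)
    fix f :: "nat \<Rightarrow> cp2 \<Rightarrow> cp2"
    assume f: "inj f \<and> range f \<subseteq> (\<lambda>\<gamma>. restrict (act \<gamma>) U) ` \<Gamma>"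
    have "\<forall>n. \<exists>\<gamma>. \<gamma> \<in> \<Gamma> \<and> f n = restrict (act \<gamma>) U" using f by auto
    then obtain g where g: "\<And>n. g n \<in> \<Gamma>" "\<And>n. f n = restrict (act (g n)) U" by metis
    obtain r M B where r: "strict_mono (r::nat \<Rightarrow> nat)"
      and M: "\<And>n. lifts (M n) (g (r n))" "M \<longlonglongrightarrow> B" "B \<noteq> 0"
      using convergent_lifts[of g] subgroup_carrier[OF sub g(1)] by blast
    have nz: "B *v v \<noteq> 0" if "v \<noteq> 0" "proj v \<in> U" for v
      using limit_nonzero_if_three_lines_omitted[OF U(2) _ U(1,3) M that] g(1) by blast
    \<comment> \<open>The map induced by \<^term>\<open>B\<close>, with an arbitrary value on the projectivized kernel of \<^term>\<open>B\<close>.\<close>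
    define h where "h = (\<lambda>p. proj (B *v rep_cp2 p))"
    have h: "h (proj v) = proj (B *v v)" if v: "v \<noteq> 0" "proj v \<in> U" for v
    proof -
      obtain c where c: "rep_cp2 (proj v) = c *s v"
        using proj_eq_iff[OF v(1) rep_cp2(1)[of "proj v"]] by (auto simp: rep_cp2(2))
      then have "c \<noteq> 0" using rep_cp2(1)[of "proj v"] by auto
      then show ?thesis using nz[OF v] by (simp add: h_def c vector_scalar_commute proj_smult)
    qed
    have "uniform_limit K (\<lambda>n. f (r n)) h sequentially" if K: "compact K" "K \<subseteq> U" for K
    proof (rule uniform_limit_compactI[OF K(1)])
      fix x y and s :: "nat \<Rightarrow> nat"
      assume x: "\<And>n. x n \<in> K" "x \<longlonglongrightarrow> y" "y \<in> K" and s: "strict_mono s"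
      obtain v where v: "v \<noteq> 0" "y = proj v" by (metis proj_cases)
      then have vU: "proj v \<in> U" using x K by auto
      have "(\<lambda>n. M (s n)) \<longlonglongrightarrow> B" using LIMSEQ_subseq_LIMSEQ[OF M(2) s] by (simp add: o_def)
      then have "(\<lambda>n. act (g (r (s n))) (x n)) \<longlonglongrightarrow> proj (B *v v)"
        using x(2) v nz[OF v(1) vU] by (intro tendsto_act_lifts[of "\<lambda>n. M (s n)"] M(1)) auto
      moreover have "f (r (s n)) (x n) = act (g (r (s n))) (x n)" for n
        using x(1) K(2) by (simp add: g(2) subset_iff)
      ultimately have 1: "(\<lambda>n. f (r (s n)) (x n)) \<longlonglongrightarrow> h y" using h[OF v(1) vU] v(2) by simp
      obtain w where w: "w \<longlonglongrightarrow> v" "\<And>n. w n \<noteq> 0" "\<And>n. proj (w n) = x n"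
        using convergent_lift[of x v] x(2) v by blast
      have "h (x n) = proj (B *v w n)" for n using h[OF w(2)[of n]] w(3)[of n] x(1)[of n] K(2) by auto
      moreover have "(\<lambda>n. proj (B *v w n)) \<longlonglongrightarrow> proj (B *v v)"
        using nz[OF v(1) vU] by (intro tendsto_proj tendsto_intros w(1))
      ultimately have 2: "(\<lambda>n. h (x n)) \<longlonglongrightarrow> h y" using h[OF v(1) vU] v(2) by simp
      show "(\<lambda>n. f (r (s n)) (x n)) \<longlonglongrightarrow> h y \<and> (\<lambda>n. h (x n)) \<longlonglongrightarrow> h y"
        using 1 2 by blast
    qed
    then show "\<exists>r h. strict_mono (r :: nat \<Rightarrow> nat) \<and>
        (\<forall>K. compact K \<and> K \<subseteq> U \<longrightarrow> uniform_limit K (\<lambda>n. f (r n)) h sequentially)"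
      using r by blast
  qed
  then show ?thesis using U(1) unfolding equicontinuity_set_def by blast
qed

section \<open>Kulkarni's limit set\<close>

lemma open_disjoint_closure: "open S \<Longrightarrow> S \<inter> T = {} \<Longrightarrow> S \<inter> closure T = {}"
  using open_Int_closure_eq_empty by blast

lemma equicontinuity_disjoint_L0:
  assumes \<Gamma>: "discrete_subgroup \<Gamma>"
  shows "equicontinuity_set \<Gamma> \<inter> kulkarni_L0 \<Gamma> = {}"
  unfolding kulkarni_L0_def
proof (rule open_disjoint_closure[OF open_equicontinuity_set])
  have "finite {\<gamma>\<in>\<Gamma>. act \<gamma> z = z}" if "z \<in> equicontinuity_set \<Gamma>" for z
  proof -
    have "finite {\<gamma>\<in>\<Gamma>. act \<gamma> ` {z} \<inter> {z} \<noteq> {}}"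
      using equicontinuity_set_properly_discontinuous[OF \<Gamma>,
          unfolded acts_properly_discontinuously_def, THEN conjunct2, THEN conjunct2,
          rule_format, of "{z}"] that by simp
    moreover have "{\<gamma>\<in>\<Gamma>. act \<gamma> ` {z} \<inter> {z} \<noteq> {}} = {\<gamma>\<in>\<Gamma>. act \<gamma> z = z}" by auto
    ultimately show ?thesis by simp
  qed
  then show "equicontinuity_set \<Gamma> \<inter> {z. infinite {\<gamma>\<in>\<Gamma>. act \<gamma> z = z}} = {}" by blast
qed

text \<open>An orbit that accumulates at an equicontinuity point meets the open invariant set of these points,
  hence stays in it, and then proper discontinuity forbids the accumulation.\<close>

lemma equicontinuity_disjoint_L1:
  assumes \<Gamma>: "discrete_subgroup \<Gamma>"
  shows "equicontinuity_set \<Gamma> \<inter> kulkarni_L1 \<Gamma> = {}"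
  unfolding kulkarni_L1_def
proof (rule open_disjoint_closure[OF open_equicontinuity_set])
  note sub = discrete_subgroup_subgroup[OF \<Gamma>]
  have "q \<notin> equicontinuity_set \<Gamma>" if q: "q \<in> cluster_points \<Gamma> {z}" for q z
  proof
    assume qE: "q \<in> equicontinuity_set \<Gamma>"
    obtain k g where k: "range k \<subseteq> {z}" and g: "inj g" "range g \<subseteq> \<Gamma>"
      and lim0: "(\<lambda>m::nat. act (g m) (k m)) \<longlonglongrightarrow> q"
      using q unfolding cluster_points_def by blast
    have "k m = z" for m using k by auto
    with lim0 have lim: "(\<lambda>m. act (g m) z) \<longlonglongrightarrow> q" by simp
    then obtain m where m: "act (g m) z \<in> equicontinuity_set \<Gamma>"
      using eventually_happens'[OF sequentially_bot topological_tendstoD[OF lim open_equicontinuity_set qE]] by blast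
    have gm: "g m \<in> \<Gamma>" using g(2) by auto
    then have "act (inv\<^bsub>PSL3\<^esub> (g m)) (act (g m) z) \<in> equicontinuity_set \<Gamma>"
      using invariant_equicontinuity_set[OF sub] m subgroup.m_inv_closed[OF sub gm]
      unfolding invariant_set_def by blast
    then have "z \<in> equicontinuity_set \<Gamma>" using act_inv(1) subgroup_carrier[OF sub gm] by simp
    then show False
      using equicontinuity_orbit_escapes[OF \<Gamma> g tendsto_const _ lim] qE by blast
  qed
  then show "equicontinuity_set \<Gamma> \<inter> (\<Union>z\<in>- kulkarni_L0 \<Gamma>. cluster_points \<Gamma> {z}) = {}" by blast
qed

text \<open>Let \<open>g n\<close> move points of \<open>K\<close> that converge to \<open>p\<close> towards an equicontinuity point \<open>q\<close>. Near \<open>q\<close> the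
  inverses converge, so they carry the constant sequence \<open>q\<close> to the same limit \<open>p\<close> as the moving
  points. Thus \<open>p\<close> is a cluster point of the orbit of \<open>q\<close>, and \<^term>\<open>kulkarni_L1 \<Gamma>\<close> contains it, whereas
  \<open>K\<close> is disjoint from that set.\<close>

lemma equicontinuity_disjoint_L2:
  assumes \<Gamma>: "discrete_subgroup \<Gamma>"
  shows "equicontinuity_set \<Gamma> \<inter> kulkarni_L2 \<Gamma> = {}"
  unfolding kulkarni_L2_def
proof (rule open_disjoint_closure[OF open_equicontinuity_set])
  note sub = discrete_subgroup_subgroup[OF \<Gamma>]
  have sc: "\<Gamma> \<subseteq> carrier PSL3" using sub by (rule subgroup.subset)
  have "q \<notin> equicontinuity_set \<Gamma>"
    if K: "compact K" "K \<subseteq> - (kulkarni_L0 \<Gamma> \<union> kulkarni_L1 \<Gamma>)" and q: "q \<in> cluster_points \<Gamma> K" for q K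
  proof
    assume qE: "q \<in> equicontinuity_set \<Gamma>"
    obtain k g where k0: "range k \<subseteq> K" and g0: "inj g" "range g \<subseteq> \<Gamma>"
      and lim0: "(\<lambda>m::nat. act (g m) (k m)) \<longlonglongrightarrow> q"
      using q unfolding cluster_points_def by blast
    have "\<forall>n. k n \<in> K" using k0 by auto
    then obtain p s where p: "p \<in> K" "strict_mono (s::nat \<Rightarrow> nat)" "(k \<circ> s) \<longlonglongrightarrow> p"
      using K(1) unfolding compact_def by blast
    define \<delta> where "\<delta> = (\<lambda>n. inv\<^bsub>PSL3\<^esub> (g (s n)))"
    have gs: "g (s n) \<in> \<Gamma>" "g (s n) \<in> carrier PSL3" for n using g0(2) sc by auto
    have \<delta>: "inj \<delta>" "range \<delta> \<subseteq> \<Gamma>"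
    proof -
      show "range \<delta> \<subseteq> \<Gamma>" using gs(1) subgroup.m_inv_closed[OF sub] by (auto simp: \<delta>_def)
      show "inj \<delta>"
      proof (rule injI)
        fix m n assume "\<delta> m = \<delta> n"
        then have "g (s m) = g (s n)" using gs(2) unfolding \<delta>_def by (metis group.inv_inv group_PSL3)
        then show "m = n" using g0(1) strict_mono_eq[OF p(2)] by (auto dest: injD)
      qed
    qed
    have dc: "\<delta> n \<in> carrier PSL3" for n using \<delta>(2) sc by auto
    obtain r N C where r: "strict_mono (r::nat \<Rightarrow> nat)"
      and N: "\<And>n. lifts (N n) (\<delta> (r n))" "N \<longlonglongrightarrow> C" "C \<noteq> 0"
      by (rule convergent_lifts[of \<delta>, OF dc]) (rule that)
    have \<delta>r: "inj (\<lambda>n. \<delta> (r n))" "range (\<lambda>n. \<delta> (r n)) \<subseteq> \<Gamma>"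
      using inj_compose[OF \<delta>(1) strict_mono_imp_inj_on[OF r]] \<delta>(2)
      unfolding o_def by blast+
    obtain v where v: "v \<noteq> 0" "q = proj v" by (metis proj_cases)
    have Cv: "C *v v \<noteq> 0"
      using equicontinuity_set_avoids_kernel[OF sc \<delta>r N v(1)] qE v(2) by simp
    have sr: "strict_mono (\<lambda>n. s (r n))" using strict_mono_o[OF p(2) r] by (simp add: o_def)
    have "(\<lambda>n. act (g (s (r n))) (k (s (r n)))) \<longlonglongrightarrow> proj v"
      using LIMSEQ_subseq_LIMSEQ[OF lim0 sr] v(2) by (simp add: o_def)
    then have "(\<lambda>n. act (\<delta> (r n)) (act (g (s (r n))) (k (s (r n))))) \<longlonglongrightarrow> proj (C *v v)"
      by (rule tendsto_act_lifts[OF N(1,2) _ v(1) Cv])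
    then have "(\<lambda>n. k (s (r n))) \<longlonglongrightarrow> proj (C *v v)"
      using gs(2) by (simp add: \<delta>_def act_inv)
    moreover have "(\<lambda>n. k (s (r n))) \<longlonglongrightarrow> p"
      using LIMSEQ_subseq_LIMSEQ[OF p(3) r] by (simp add: o_def)
    ultimately have "p = proj (C *v v)" using LIMSEQ_unique by blast
    moreover have "(\<lambda>n. act (\<delta> (r n)) q) \<longlonglongrightarrow> proj (C *v v)"
      by (rule tendsto_act_lifts[OF N(1,2) _ v(1) Cv]) (simp add: v(2))
    ultimately have "p \<in> cluster_points \<Gamma> {q}"
      unfolding cluster_points_def using \<delta>r
      by (intro CollectI exI[of _ "\<lambda>_. q"] exI[of _ "\<lambda>n. \<delta> (r n)"]) auto
    moreover have "q \<in> - kulkarni_L0 \<Gamma>" using equicontinuity_disjoint_L0[OF \<Gamma>] qE by blast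
    ultimately have "p \<in> (\<Union>z\<in>- kulkarni_L0 \<Gamma>. cluster_points \<Gamma> {z})" by (rule UN_I[rotated])
    then have "p \<in> kulkarni_L1 \<Gamma>"
      unfolding kulkarni_L1_def by (rule subsetD[OF closure_subset])
    then show False using p(1) K(2) by blast
  qed
  then show "equicontinuity_set \<Gamma> \<inter> (\<Union>K\<in>{K. compact K \<and> K \<subseteq> - (kulkarni_L0 \<Gamma> \<union> kulkarni_L1 \<Gamma>)}.
      cluster_points \<Gamma> K) = {}" by blast
qed

lemma equicontinuity_set_subset_kulkarni_region:
  assumes "discrete_subgroup \<Gamma>"
  shows "equicontinuity_set \<Gamma> \<subseteq> kulkarni_region \<Gamma>"
  using equicontinuity_disjoint_L0[OF assms] equicontinuity_disjoint_L1[OF assms]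
    equicontinuity_disjoint_L2[OF assms]
  unfolding kulkarni_region_def kulkarni_limit_set_def by blast

lemma act_cluster_points:
  assumes sub: "subgroup \<Gamma> PSL3" and \<gamma>: "\<gamma> \<in> \<Gamma>" and q: "q \<in> cluster_points \<Gamma> K"
  shows "act \<gamma> q \<in> cluster_points \<Gamma> K"
proof -
  interpret group PSL3 by (rule group_PSL3)
  obtain k g where k: "range k \<subseteq> K" and g: "inj g" "range g \<subseteq> \<Gamma>"
    and lim: "(\<lambda>m::nat. act (g m) (k m)) \<longlonglongrightarrow> q"
    using q unfolding cluster_points_def by blast
  have c: "\<gamma> \<in> carrier PSL3" "g m \<in> carrier PSL3" for m
    using subgroup_carrier[OF sub] \<gamma> g(2) by auto
  have "inj (\<lambda>m. \<gamma> \<otimes>\<^bsub>PSL3\<^esub> g m)" using g(1) c by (auto simp: inj_def)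
  moreover have "range (\<lambda>m. \<gamma> \<otimes>\<^bsub>PSL3\<^esub> g m) \<subseteq> \<Gamma>"
    using subgroup.m_closed[OF sub \<gamma>] g(2) by auto
  moreover have "(\<lambda>m. act (\<gamma> \<otimes>\<^bsub>PSL3\<^esub> g m) (k m)) \<longlonglongrightarrow> act \<gamma> q"
    using tendsto_act[OF c(1) lim] c by (simp add: act_mult)
  ultimately show ?thesis unfolding cluster_points_def using k by blast
qed

lemma invariant_kulkarni_L0:
  assumes sub: "subgroup \<Gamma> PSL3"
  shows "invariant_set \<Gamma> (kulkarni_L0 \<Gamma>)"
  unfolding kulkarni_L0_def
proof (rule invariant_set_closure[OF sub], rule invariant_setI[OF sub])
  interpret group PSL3 by (rule group_PSL3)
  fix \<gamma> assume \<gamma>: "\<gamma> \<in> \<Gamma>"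
  note c = subgroup_carrier[OF sub]
  have "infinite {\<delta>\<in>\<Gamma>. act \<delta> (act \<gamma> z) = act \<gamma> z}" if z: "infinite {\<delta>\<in>\<Gamma>. act \<delta> z = z}" for z
  proof -
    let ?c = "\<lambda>\<delta>. \<gamma> \<otimes>\<^bsub>PSL3\<^esub> \<delta> \<otimes>\<^bsub>PSL3\<^esub> inv\<^bsub>PSL3\<^esub> \<gamma>"
    have "inj_on ?c \<Gamma>" using c \<gamma> by (auto simp: inj_on_def)
    then have "inj_on ?c {\<delta>\<in>\<Gamma>. act \<delta> z = z}" by (rule inj_on_subset) auto
    then have "infinite (?c ` {\<delta>\<in>\<Gamma>. act \<delta> z = z})" using z by (simp add: finite_image_iff)
    moreover have "?c ` {\<delta>\<in>\<Gamma>. act \<delta> z = z} \<subseteq> {\<delta>\<in>\<Gamma>. act \<delta> (act \<gamma> z) = act \<gamma> z}"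
      using c \<gamma> subgroup.m_closed[OF sub] subgroup.m_inv_closed[OF sub]
      by (auto simp: act_mult act_inv)
    ultimately show ?thesis using finite_subset by blast
  qed
  then show "act \<gamma> ` {z. infinite {\<delta>\<in>\<Gamma>. act \<delta> z = z}} \<subseteq> {z. infinite {\<delta>\<in>\<Gamma>. act \<delta> z = z}}"
    by auto
qed

lemma invariant_kulkarni_region:
  assumes sub: "subgroup \<Gamma> PSL3"
  shows "invariant_set \<Gamma> (kulkarni_region \<Gamma>)"
proof -
  have "invariant_set \<Gamma> (kulkarni_L1 \<Gamma>)" "invariant_set \<Gamma> (kulkarni_L2 \<Gamma>)"
    unfolding kulkarni_L1_def kulkarni_L2_def
    by (rule invariant_set_closure[OF sub], rule invariant_setI[OF sub],
        use act_cluster_points[OF sub] in blast)+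
  then have \<Lambda>: "invariant_set \<Gamma> (kulkarni_limit_set \<Gamma>)"
    using invariant_kulkarni_L0[OF sub]
    by (simp add: kulkarni_limit_set_def invariant_set_def image_Un)
  show ?thesis
  proof (rule invariant_setI[OF sub])
    fix \<gamma> assume \<gamma>: "\<gamma> \<in> \<Gamma>"
    have "p \<in> kulkarni_limit_set \<Gamma>" if "act \<gamma> p \<in> kulkarni_limit_set \<Gamma>" for p
    proof -
      have "act (inv\<^bsub>PSL3\<^esub> \<gamma>) (act \<gamma> p) \<in> kulkarni_limit_set \<Gamma>"
        using \<Lambda> that subgroup.m_inv_closed[OF sub \<gamma>] unfolding invariant_set_def by blast
      then show ?thesis using act_inv(1)[OF subgroup_carrier[OF sub \<gamma>]] by simp
    qed
    then show "act \<gamma> ` kulkarni_region \<Gamma> \<subseteq> kulkarni_region \<Gamma>"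
      by (auto simp: kulkarni_region_def)
  qed
qed

lemma open_kulkarni_region: "open (kulkarni_region \<Gamma>)"
  unfolding kulkarni_region_def kulkarni_limit_set_def kulkarni_L0_def kulkarni_L1_def kulkarni_L2_def
  by (intro open_Compl closed_Un closed_closure)

theorem theorem0p1:
  fixes \<Gamma> :: "(complex^3^3) set set"
  assumes "discrete_subgroup \<Gamma>"
  shows "acts_properly_discontinuously \<Gamma> (equicontinuity_set \<Gamma>)
    \<and> (\<forall>U. open U \<and> invariant_set \<Gamma> U \<and> contains_three_lines_gp (- U)
            \<longrightarrow> U \<subseteq> equicontinuity_set \<Gamma>)
    \<and> (contains_three_lines_gp (kulkarni_limit_set \<Gamma>)
            \<longrightarrow> kulkarni_region \<Gamma> = equicontinuity_set \<Gamma>)"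
proof (intro conjI allI impI)
  note sub = discrete_subgroup_subgroup[OF assms]
  show "acts_properly_discontinuously \<Gamma> (equicontinuity_set \<Gamma>)"
    by (rule equicontinuity_set_properly_discontinuous[OF assms])
  show "U \<subseteq> equicontinuity_set \<Gamma>"
    if "open U \<and> invariant_set \<Gamma> U \<and> contains_three_lines_gp (- U)" for U
    using three_lines_omitted_subset_equicontinuity_set[OF sub] that by blast
  assume "contains_three_lines_gp (kulkarni_limit_set \<Gamma>)"
  then have "kulkarni_region \<Gamma> \<subseteq> equicontinuity_set \<Gamma>"
    using open_kulkarni_region invariant_kulkarni_region[OF sub]
    by (intro three_lines_omitted_subset_equicontinuity_set[OF sub]) (simp_all add: kulkarni_region_def)
  then show "kulkarni_region \<Gamma> = equicontinuity_set \<Gamma>"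
    using equicontinuity_set_subset_kulkarni_region[OF assms] by blast
qed

end
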